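(* Let $A=R(\sigma,a)$ be a generalized Weyl algebra over the (commutative) principal ideal domain $R$, with $\sigma\in\mathrm{Aut}(R)$ and $0\ne a\in R$. Then all $A$-modules that are free of rank $1$ over $R$ are simple (as $A$-modules) if and only if either $R$ is a field, or $A$ is a simple ring.
   Context: Modules are left and unital. The generalized Weyl algebra $R(\sigma,a)$ is the ring generated by $R$, $x$, $y$ subject to $x\sigma(r)=rx$, $yr=\sigma(r)y$ for all $r\in R$, $xy=a$, $yx=\sigma(a)$. *)

theory Defs
  imports "HOL-Algebra.Ring_Divisibility"
begin

section \<open>Generalized Weyl algebras\<close>

text \<open>
  \<open>gwa R \<sigma> a\<close> is given by the presentation itself: ring expressions in the symbols
  \<open>x\<close>, \<open>y\<close> and the elements of \<open>R\<close>, modulo the least congruence that contains the ring axioms,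
  the operations of \<open>R\<close>, and the defining relations.  The zero and the one of the ring are
  \<open>Coeff \<zero>\<close> and \<open>Coeff \<one>\<close>, so that \<open>R\<close> maps to \<open>gwa R \<sigma> a\<close> by a unital homomorphism.
\<close>

datatype 'a gwa_term =
    Coeff 'a
  | GenX
  | GenY
  | Plus "'a gwa_term" "'a gwa_term"
  | Minus "'a gwa_term"
  | Times "'a gwa_term" "'a gwa_term"

inductive_set gwa_terms :: "('a, 'r) ring_scheme \<Rightarrow> 'a gwa_term set"
  for R :: "('a, 'r) ring_scheme" where
  Coeff: "r \<in> carrier R \<Longrightarrow> Coeff r \<in> gwa_terms R"
| GenX: "GenX \<in> gwa_terms R"
| GenY: "GenY \<in> gwa_terms R"
| Plus: "s \<in> gwa_terms R \<Longrightarrow> t \<in> gwa_terms R \<Longrightarrow> Plus s t \<in> gwa_terms R"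
| Minus: "t \<in> gwa_terms R \<Longrightarrow> Minus t \<in> gwa_terms R"
| Times: "s \<in> gwa_terms R \<Longrightarrow> t \<in> gwa_terms R \<Longrightarrow> Times s t \<in> gwa_terms R"

inductive_set gwa_rel ::
    "('a, 'r) ring_scheme \<Rightarrow> ('a \<Rightarrow> 'a) \<Rightarrow> 'a \<Rightarrow> ('a gwa_term \<times> 'a gwa_term) set"
  for R :: "('a, 'r) ring_scheme" (structure) and \<sigma> :: "'a \<Rightarrow> 'a" and a :: 'a where
  refl: "t \<in> gwa_terms R \<Longrightarrow> (t, t) \<in> gwa_rel R \<sigma> a"
| sym: "(s, t) \<in> gwa_rel R \<sigma> a \<Longrightarrow> (t, s) \<in> gwa_rel R \<sigma> a"
| trans: "(s, t) \<in> gwa_rel R \<sigma> a \<Longrightarrow> (t, u) \<in> gwa_rel R \<sigma> a \<Longrightarrow> (s, u) \<in> gwa_rel R \<sigma> a"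
| cong_Plus: "(s, s') \<in> gwa_rel R \<sigma> a \<Longrightarrow> (t, t') \<in> gwa_rel R \<sigma> a
    \<Longrightarrow> (Plus s t, Plus s' t') \<in> gwa_rel R \<sigma> a"
| cong_Minus: "(t, t') \<in> gwa_rel R \<sigma> a \<Longrightarrow> (Minus t, Minus t') \<in> gwa_rel R \<sigma> a"
| cong_Times: "(s, s') \<in> gwa_rel R \<sigma> a \<Longrightarrow> (t, t') \<in> gwa_rel R \<sigma> a
    \<Longrightarrow> (Times s t, Times s' t') \<in> gwa_rel R \<sigma> a"
  \<comment> \<open>ring axioms\<close>
| add_assoc: "s \<in> gwa_terms R \<Longrightarrow> t \<in> gwa_terms R \<Longrightarrow> u \<in> gwa_terms R
    \<Longrightarrow> (Plus (Plus s t) u, Plus s (Plus t u)) \<in> gwa_rel R \<sigma> a"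
| add_comm: "s \<in> gwa_terms R \<Longrightarrow> t \<in> gwa_terms R \<Longrightarrow> (Plus s t, Plus t s) \<in> gwa_rel R \<sigma> a"
| add_zero: "t \<in> gwa_terms R \<Longrightarrow> (Plus (Coeff \<zero>) t, t) \<in> gwa_rel R \<sigma> a"
| add_minus: "t \<in> gwa_terms R \<Longrightarrow> (Plus (Minus t) t, Coeff \<zero>) \<in> gwa_rel R \<sigma> a"
| mult_assoc: "s \<in> gwa_terms R \<Longrightarrow> t \<in> gwa_terms R \<Longrightarrow> u \<in> gwa_terms R
    \<Longrightarrow> (Times (Times s t) u, Times s (Times t u)) \<in> gwa_rel R \<sigma> a"
| mult_one_left: "t \<in> gwa_terms R \<Longrightarrow> (Times (Coeff \<one>) t, t) \<in> gwa_rel R \<sigma> a"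
| mult_one_right: "t \<in> gwa_terms R \<Longrightarrow> (Times t (Coeff \<one>), t) \<in> gwa_rel R \<sigma> a"
| distrib_right: "s \<in> gwa_terms R \<Longrightarrow> t \<in> gwa_terms R \<Longrightarrow> u \<in> gwa_terms R
    \<Longrightarrow> (Times (Plus s t) u, Plus (Times s u) (Times t u)) \<in> gwa_rel R \<sigma> a"
| distrib_left: "s \<in> gwa_terms R \<Longrightarrow> t \<in> gwa_terms R \<Longrightarrow> u \<in> gwa_terms R
    \<Longrightarrow> (Times u (Plus s t), Plus (Times u s) (Times u t)) \<in> gwa_rel R \<sigma> a"
  \<comment> \<open>operations of \<open>R\<close>\<close>
| coeff_add: "r \<in> carrier R \<Longrightarrow> s \<in> carrier R
    \<Longrightarrow> (Coeff (r \<oplus> s), Plus (Coeff r) (Coeff s)) \<in> gwa_rel R \<sigma> a"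
| coeff_mult: "r \<in> carrier R \<Longrightarrow> s \<in> carrier R
    \<Longrightarrow> (Coeff (r \<otimes> s), Times (Coeff r) (Coeff s)) \<in> gwa_rel R \<sigma> a"
  \<comment> \<open>defining relations \<open>x \<sigma>(r) = r x\<close>, \<open>y r = \<sigma>(r) y\<close>, \<open>x y = a\<close>, \<open>y x = \<sigma>(a)\<close>\<close>
| rel_x: "r \<in> carrier R
    \<Longrightarrow> (Times GenX (Coeff (\<sigma> r)), Times (Coeff r) GenX) \<in> gwa_rel R \<sigma> a"
| rel_y: "r \<in> carrier R
    \<Longrightarrow> (Times GenY (Coeff r), Times (Coeff (\<sigma> r)) GenY) \<in> gwa_rel R \<sigma> a"
| rel_xy: "(Times GenX GenY, Coeff a) \<in> gwa_rel R \<sigma> a"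
| rel_yx: "(Times GenY GenX, Coeff (\<sigma> a)) \<in> gwa_rel R \<sigma> a"

definition gwa_class ::
    "('a, 'r) ring_scheme \<Rightarrow> ('a \<Rightarrow> 'a) \<Rightarrow> 'a \<Rightarrow> 'a gwa_term \<Rightarrow> 'a gwa_term set" where
  "gwa_class R \<sigma> a t = gwa_rel R \<sigma> a `` {t}"

definition gwa :: "('a, 'r) ring_scheme \<Rightarrow> ('a \<Rightarrow> 'a) \<Rightarrow> 'a \<Rightarrow> 'a gwa_term set ring" where
  "gwa R \<sigma> a =
    \<lparr>carrier = gwa_terms R // gwa_rel R \<sigma> a,
     monoid.mult = (\<lambda>S T. \<Union>s\<in>S. \<Union>t\<in>T. gwa_class R \<sigma> a (Times s t)),
     one = gwa_class R \<sigma> a (Coeff \<one>\<^bsub>R\<^esub>),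
     zero = gwa_class R \<sigma> a (Coeff \<zero>\<^bsub>R\<^esub>),
     add = (\<lambda>S T. \<Union>s\<in>S. \<Union>t\<in>T. gwa_class R \<sigma> a (Plus s t))\<rparr>"

definition gwa_coeff ::
    "('a, 'r) ring_scheme \<Rightarrow> ('a \<Rightarrow> 'a) \<Rightarrow> 'a \<Rightarrow> 'a \<Rightarrow> 'a gwa_term set" where
  "gwa_coeff R \<sigma> a r = gwa_class R \<sigma> a (Coeff r)"


section \<open>Modules over noncommutative rings\<close>

text \<open>
  The library locale \<open>module\<close> requires a commutative ring of scalars, hence the locale below.
  As there, the multiplicative fields of the record \<open>M\<close> play no role.
\<close>

locale left_module = R?: ring R + M?: abelian_group M
    for R :: "('s, 'r) ring_scheme" (structure)
    and M :: "('s, 'm, 'e) module_scheme" (structure) +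
  assumes smult_closed:
      "\<lbrakk>r \<in> carrier R; v \<in> carrier M\<rbrakk> \<Longrightarrow> r \<odot>\<^bsub>M\<^esub> v \<in> carrier M"
    and smult_l_distr:
      "\<lbrakk>r \<in> carrier R; s \<in> carrier R; v \<in> carrier M\<rbrakk>
        \<Longrightarrow> (r \<oplus>\<^bsub>R\<^esub> s) \<odot>\<^bsub>M\<^esub> v = r \<odot>\<^bsub>M\<^esub> v \<oplus>\<^bsub>M\<^esub> s \<odot>\<^bsub>M\<^esub> v"
    and smult_r_distr:
      "\<lbrakk>r \<in> carrier R; v \<in> carrier M; w \<in> carrier M\<rbrakk>
        \<Longrightarrow> r \<odot>\<^bsub>M\<^esub> (v \<oplus>\<^bsub>M\<^esub> w) = r \<odot>\<^bsub>M\<^esub> v \<oplus>\<^bsub>M\<^esub> r \<odot>\<^bsub>M\<^esub> w"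
    and smult_assoc:
      "\<lbrakk>r \<in> carrier R; s \<in> carrier R; v \<in> carrier M\<rbrakk>
        \<Longrightarrow> (r \<otimes>\<^bsub>R\<^esub> s) \<odot>\<^bsub>M\<^esub> v = r \<odot>\<^bsub>M\<^esub> (s \<odot>\<^bsub>M\<^esub> v)"
    and smult_one:
      "v \<in> carrier M \<Longrightarrow> \<one>\<^bsub>R\<^esub> \<odot>\<^bsub>M\<^esub> v = v"

definition simple_module :: "('s, 'r) ring_scheme \<Rightarrow> ('s, 'm, 'e) module_scheme \<Rightarrow> bool" where
  "simple_module R M \<longleftrightarrow> left_module R M \<and> carrier M \<noteq> {\<zero>\<^bsub>M\<^esub>} \<and>
    (\<forall>N. submodule N R M \<longrightarrow> N = {\<zero>\<^bsub>M\<^esub>} \<or> N = carrier M)"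

definition simple_ring :: "('s, 'r) ring_scheme \<Rightarrow> bool" where
  "simple_ring R \<longleftrightarrow> ring R \<and> carrier R \<noteq> {\<zero>\<^bsub>R\<^esub>} \<and>
    (\<forall>I. ideal I R \<longrightarrow> I = {\<zero>\<^bsub>R\<^esub>} \<or> I = carrier R)"

definition restrict_scalars :: "('r \<Rightarrow> 's) \<Rightarrow> ('s, 'm) module \<Rightarrow> ('r, 'm) module" where
  "restrict_scalars \<phi> M =
    \<lparr>carrier = carrier M, monoid.mult = monoid.mult M, one = monoid.one M,
     zero = ring.zero M, add = ring.add M,
     smult = (\<lambda>r v. \<phi> r \<odot>\<^bsub>M\<^esub> v)\<rparr>"

definition free_of_rank ::
    "('s, 'r) ring_scheme \<Rightarrow> nat \<Rightarrow> ('s, 'm, 'e) module_scheme \<Rightarrow> bool" where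
  "free_of_rank R n M \<longleftrightarrow>
    (\<exists>B \<subseteq> carrier M. finite B \<and> card B = n \<and>
      (\<forall>v \<in> carrier M. \<exists>!c. c \<in> B \<rightarrow>\<^sub>E carrier R \<and> v = (\<Oplus>\<^bsub>M\<^esub>b\<in>B. c b \<odot>\<^bsub>M\<^esub> b)))"


section \<open>The generalized Weyl algebra is a ring containing an image of \<open>R\<close>\<close>

context
  fixes R :: "('a, 'r) ring_scheme" (structure) and \<sigma> :: "'a \<Rightarrow> 'a" and a :: 'a
  assumes R: "ring R" and \<sigma>: "\<sigma> \<in> ring_hom R R" and a: "a \<in> carrier R"
begin

interpretation ring R by (rule R)

lemma gwa_rel_terms:
  "(s, t) \<in> gwa_rel R \<sigma> a \<Longrightarrow> s \<in> gwa_terms R \<and> t \<in> gwa_terms R"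
  by (induction rule: gwa_rel.induct)
    (auto intro!: gwa_terms.intros a ring_hom_closed[OF \<sigma>])

lemma gwa_equiv: "equiv (gwa_terms R) (gwa_rel R \<sigma> a)"
  using gwa_rel_terms
  by (auto intro!: equivI refl_onI symI transI intro: gwa_rel.refl gwa_rel.sym gwa_rel.trans)

lemma gwa_class_eqI:
  "(s, t) \<in> gwa_rel R \<sigma> a \<Longrightarrow> gwa_class R \<sigma> a s = gwa_class R \<sigma> a t"
  unfolding gwa_class_def by (rule equiv_class_eq[OF gwa_equiv])

lemma gwa_carrier: "carrier (gwa R \<sigma> a) = gwa_class R \<sigma> a ` gwa_terms R"
  by (auto simp: gwa_def quotient_def gwa_class_def)

lemma gwa_mult:
  assumes "s \<in> gwa_terms R" "t \<in> gwa_terms R"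
  shows "gwa_class R \<sigma> a s \<otimes>\<^bsub>gwa R \<sigma> a\<^esub> gwa_class R \<sigma> a t = gwa_class R \<sigma> a (Times s t)"
proof -
  have "congruent2 (gwa_rel R \<sigma> a) (gwa_rel R \<sigma> a) (\<lambda>s t. gwa_class R \<sigma> a (Times s t))"
    by (intro congruent2I' gwa_class_eqI gwa_rel.cong_Times)
  from UN_equiv_class2[OF gwa_equiv gwa_equiv this assms] show ?thesis
    by (simp add: gwa_def gwa_class_def)
qed

lemma gwa_add:
  assumes "s \<in> gwa_terms R" "t \<in> gwa_terms R"
  shows "gwa_class R \<sigma> a s \<oplus>\<^bsub>gwa R \<sigma> a\<^esub> gwa_class R \<sigma> a t = gwa_class R \<sigma> a (Plus s t)"
proof -
  have "congruent2 (gwa_rel R \<sigma> a) (gwa_rel R \<sigma> a) (\<lambda>s t. gwa_class R \<sigma> a (Plus s t))"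
    by (intro congruent2I' gwa_class_eqI gwa_rel.cong_Plus)
  from UN_equiv_class2[OF gwa_equiv gwa_equiv this assms] show ?thesis
    by (simp add: gwa_def gwa_class_def)
qed

lemma gwa_one: "\<one>\<^bsub>gwa R \<sigma> a\<^esub> = gwa_class R \<sigma> a (Coeff \<one>)"
  and gwa_zero: "\<zero>\<^bsub>gwa R \<sigma> a\<^esub> = gwa_class R \<sigma> a (Coeff \<zero>)"
  by (simp_all add: gwa_def)

lemma gwa_ring: "ring (gwa R \<sigma> a)"
proof (intro ringI abelian_groupI monoidI)
  fix u assume "u \<in> carrier (gwa R \<sigma> a)"
  then obtain t where t: "t \<in> gwa_terms R" "u = gwa_class R \<sigma> a t"
    by (auto simp: gwa_carrier)
  show "\<exists>v \<in> carrier (gwa R \<sigma> a). v \<oplus>\<^bsub>gwa R \<sigma> a\<^esub> u = \<zero>\<^bsub>gwa R \<sigma> a\<^esub>"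
    by (rule bexI[of _ "gwa_class R \<sigma> a (Minus t)"])
      (auto simp: t gwa_add gwa_zero gwa_carrier gwa_terms.intros
        intro!: gwa_class_eqI gwa_rel.add_minus del: equalityI)
qed (auto simp: gwa_carrier gwa_add gwa_mult gwa_one gwa_zero gwa_terms.intros
    intro!: gwa_class_eqI intro: gwa_rel.intros(7-) del: equalityI)

lemma gwa_coeff_hom: "gwa_coeff R \<sigma> a \<in> ring_hom R (gwa R \<sigma> a)"
  by (rule ring_hom_memI)
    (auto simp: gwa_coeff_def gwa_carrier gwa_add gwa_mult gwa_one gwa_terms.intros
      intro!: gwa_class_eqI intro: gwa_rel.coeff_add gwa_rel.coeff_mult del: equalityI)

end

end

theory Submission
  imports Defs
begin

text \<open>
  If \<open>A\<close> is simple and \<open>N\<close> is a submodule containing \<open>r v \<noteq> 0\<close> of a module \<open>M = R v\<close>, then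
  \<open>{u \<in> A. u M \<subseteq> N}\<close> is a two-sided ideal containing \<open>r \<noteq> 0\<close>, so it contains \<open>1\<close> and \<open>N = M\<close>.

  Conversely, every factorization \<open>a = f h\<close> gives a module structure on \<open>R\<close>, namely
  \<open>x v = \<sigma>\<inverse>(v) f\<close> and \<open>y v = \<sigma>(v) \<sigma>(h)\<close>; its submodules are the ideals of \<open>R\<close> stable under these
  two maps.  If \<open>R\<close> is not a field and all these modules are simple, then \<open>\<sigma>\<close> has infinite order
  (otherwise the product over the orbit of a nonunit generates a submodule), and so a nonzero ideal
  \<open>I\<close> of \<open>A\<close>, by a commutator argument on a shortest element, contains a nonzero element of \<open>R\<close>.
  The \<open>r \<in> R\<close> with \<open>r y\<^sup>n \<in> I\<close> for some \<open>n\<close> form a submodule of the module for \<open>a = a \<cdot> 1\<close>, whence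
  \<open>y\<^sup>n \<in> I\<close> for some \<open>n\<close>.  As \<open>x y\<^sup>n = a y\<^bsup>n-1\<^esup>\<close> and \<open>y\<^sup>n x = \<sigma>\<^sup>n(a) y\<^bsup>n-1\<^esup>\<close>, the least such \<open>n\<close> is \<open>0\<close>
  once \<open>a\<close> and \<open>\<sigma>\<^sup>n(a)\<close> are coprime for \<open>n > 0\<close>.  If a prime \<open>p = \<sigma>\<^sup>n(q)\<close> divided both, then
  \<open>q\<close> and \<open>p\<close> would divide \<open>a\<close>, and \<open>\<sigma>(q) \<cdots> \<sigma>\<^sup>n(q)\<close> would generate a proper submodule for a
  suitable factorization of \<open>a\<close>.
\<close>

section \<open>Modules generated by one element over \<open>R\<close>\<close>

lemma (in left_module) zero_smult:
  assumes "v \<in> carrier M"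
  shows "\<zero> \<odot>\<^bsub>M\<^esub> v = \<zero>\<^bsub>M\<^esub>"
proof -
  have "\<zero> \<odot>\<^bsub>M\<^esub> v \<oplus>\<^bsub>M\<^esub> \<zero> \<odot>\<^bsub>M\<^esub> v = \<zero> \<odot>\<^bsub>M\<^esub> v"
    using smult_l_distr[of \<zero> \<zero> v] assms by simp
  then show ?thesis
    using assms M.add.l_cancel_one' R.zero_closed smult_closed by metis
qed

lemma (in left_module) smult_zero:
  assumes "r \<in> carrier R"
  shows "r \<odot>\<^bsub>M\<^esub> \<zero>\<^bsub>M\<^esub> = \<zero>\<^bsub>M\<^esub>"
proof -
  have "r \<odot>\<^bsub>M\<^esub> \<zero>\<^bsub>M\<^esub> \<oplus>\<^bsub>M\<^esub> r \<odot>\<^bsub>M\<^esub> \<zero>\<^bsub>M\<^esub> = r \<odot>\<^bsub>M\<^esub> \<zero>\<^bsub>M\<^esub>"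
    using smult_r_distr[of r "\<zero>\<^bsub>M\<^esub>" "\<zero>\<^bsub>M\<^esub>"] assms by simp
  then show ?thesis
    using assms M.add.l_cancel_one' M.zero_closed smult_closed by metis
qed

text \<open>The condition is imposed on all of \<open>M\<close>, so it survives right
  multiplication: \<open>u \<otimes> x\<close> sends \<open>m\<close> to \<open>u\<close> applied to
  \<open>x m\<close>, which is again a vector. Left multiplication uses that \<open>N\<close> is a
  submodule.\<close>

lemma (in left_module) transporter_ideal:
  assumes N: "submodule N R M"
  shows "ideal {u \<in> carrier R. \<forall>m \<in> carrier M. u \<odot>\<^bsub>M\<^esub> m \<in> N} R"
proof (rule idealI)
  interpret N: submodule N R M by (rule N)
  show "ring R" by (rule R.ring_axioms)
  have N_carrier: "n \<in> carrier M" if "n \<in> N" for n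
    using N.subset that by auto
  have N_add: "n \<oplus>\<^bsub>M\<^esub> n' \<in> N" if "n \<in> N" "n' \<in> N" for n n'
    using N.m_closed that by auto
  have N_zero: "\<zero>\<^bsub>M\<^esub> \<in> N"
    using N.one_closed by auto
  \<comment> \<open>Moving the sign onto the vector reduces closure under negation to the same
    condition at the vector \<open>- m\<close>.\<close>
  have uminus: "(\<ominus> u) \<odot>\<^bsub>M\<^esub> m = u \<odot>\<^bsub>M\<^esub> ((\<ominus> \<one>) \<odot>\<^bsub>M\<^esub> m)"
    if "u \<in> carrier R" "m \<in> carrier M" for u m
    using that smult_assoc[of u "\<ominus> \<one>" m] by (simp add: R.r_minus)
  show "subgroup {u \<in> carrier R. \<forall>m \<in> carrier M. u \<odot>\<^bsub>M\<^esub> m \<in> N} (add_monoid R)"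
  proof (rule R.add.subgroupI)
    show "{u \<in> carrier R. \<forall>m \<in> carrier M. u \<odot>\<^bsub>M\<^esub> m \<in> N} \<noteq> {}"
      using N_zero by (auto intro!: exI[of _ \<zero>] simp: zero_smult)
    show "\<ominus> u \<in> {u \<in> carrier R. \<forall>m \<in> carrier M. u \<odot>\<^bsub>M\<^esub> m \<in> N}"
      if "u \<in> {u \<in> carrier R. \<forall>m \<in> carrier M. u \<odot>\<^bsub>M\<^esub> m \<in> N}" for u
      using that uminus[of u] smult_closed[of "\<ominus> \<one>"] by auto
  qed (auto simp: smult_l_distr N_add)
  show "x \<otimes> u \<in> {u \<in> carrier R. \<forall>m \<in> carrier M. u \<odot>\<^bsub>M\<^esub> m \<in> N}"
    if "u \<in> {u \<in> carrier R. \<forall>m \<in> carrier M. u \<odot>\<^bsub>M\<^esub> m \<in> N}" "x \<in> carrier R" for u x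
    using that by (auto simp: smult_assoc)
  show "u \<otimes> x \<in> {u \<in> carrier R. \<forall>m \<in> carrier M. u \<odot>\<^bsub>M\<^esub> m \<in> N}"
    if "u \<in> {u \<in> carrier R. \<forall>m \<in> carrier M. u \<odot>\<^bsub>M\<^esub> m \<in> N}" "x \<in> carrier R" for u x
    using that by (auto simp: smult_assoc smult_closed)
qed

text \<open>A one-element basis spans. Its element is nonzero because otherwise the coefficients 0
  and 1 would both represent the zero vector, against uniqueness.\<close>

lemma free_of_rank_one_generator:
  assumes R: "ring R" "\<one>\<^bsub>R\<^esub> \<noteq> \<zero>\<^bsub>R\<^esub>" and \<phi>: "\<phi> \<in> ring_hom R A" and M: "left_module A M"
    and free: "free_of_rank R 1 (restrict_scalars \<phi> M)"
  obtains v where "v \<in> carrier M" "v \<noteq> \<zero>\<^bsub>M\<^esub>"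
    "\<And>w. w \<in> carrier M \<Longrightarrow> \<exists>r \<in> carrier R. w = \<phi> r \<odot>\<^bsub>M\<^esub> v"
proof -
  interpret R: ring R by (rule R)
  interpret M: left_module A M by (rule M)
  let ?M = "restrict_scalars \<phi> M"
  interpret rM: abelian_monoid ?M
    by (rule abelian_monoidI) (auto simp: restrict_scalars_def M.M.a_assoc intro: M.M.a_comm)
  obtain B where B: "B \<subseteq> carrier M" "card B = 1" and
    uniq: "\<And>w. w \<in> carrier M \<Longrightarrow>
      \<exists>!c. c \<in> B \<rightarrow>\<^sub>E carrier R \<and> w = (\<Oplus>\<^bsub>?M\<^esub>b\<in>B. \<phi> (c b) \<odot>\<^bsub>M\<^esub> b)"
    using free unfolding free_of_rank_def by (auto simp: restrict_scalars_def)
  then obtain v where v: "B = {v}" "v \<in> carrier M"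
    by (auto simp: card_Suc_eq)
  have sum: "(\<Oplus>\<^bsub>?M\<^esub>b\<in>B. \<phi> (c b) \<odot>\<^bsub>M\<^esub> b) = \<phi> (c v) \<odot>\<^bsub>M\<^esub> v" if "c \<in> B \<rightarrow>\<^sub>E carrier R" for c
  proof -
    have "\<phi> (c v) \<odot>\<^bsub>M\<^esub> v \<in> carrier M"
      using that v ring_hom_closed[OF \<phi>] M.smult_closed by auto
    then show ?thesis
      using v by (subst v(1), subst rM.finsum_insert) (simp_all only: rM.finsum_empty, auto simp: restrict_scalars_def)
  qed
  have "v \<noteq> \<zero>\<^bsub>M\<^esub>"
  proof
    assume v0: "v = \<zero>\<^bsub>M\<^esub>"
    \<comment> \<open>Constant coefficient families, restricted to \<open>B\<close> so that they are
      extensional as \<open>free_of_rank\<close> demands.\<close>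
    define k where "k = (\<lambda>r :: 'a.  \<lambda>b\<in>B. r)" 
    have "k r \<in> B \<rightarrow>\<^sub>E carrier R \<and> \<zero>\<^bsub>M\<^esub> = (\<Oplus>\<^bsub>?M\<^esub>b\<in>B. \<phi> (k r b) \<odot>\<^bsub>M\<^esub> b)" if "r \<in> carrier R" for r
    proof -
      have "k r \<in> B \<rightarrow>\<^sub>E carrier R" using that by (auto simp: k_def)
      then show ?thesis
        using that v0 ring_hom_closed[OF \<phi>] by (subst sum) (auto simp: k_def v M.smult_zero)
    qed
    then have "k \<one>\<^bsub>R\<^esub> = k \<zero>\<^bsub>R\<^esub>"
      using uniq[OF M.M.zero_closed] by blast
    then have "k \<one>\<^bsub>R\<^esub> v = k \<zero>\<^bsub>R\<^esub> v" by simp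
    then show False using R(2) v by (simp add: k_def)
  qed
  moreover have "\<exists>r \<in> carrier R. w = \<phi> r \<odot>\<^bsub>M\<^esub> v" if w: "w \<in> carrier M" for w
  proof -
    obtain c where c: "c \<in> B \<rightarrow>\<^sub>E carrier R" "w = (\<Oplus>\<^bsub>?M\<^esub>b\<in>B. \<phi> (c b) \<odot>\<^bsub>M\<^esub> b)"
      using uniq[OF w] by blast
    then have "w = \<phi> (c v) \<odot>\<^bsub>M\<^esub> v" "c v \<in> carrier R"
      using sum v by auto
    then show ?thesis by blast
  qed
  ultimately show thesis using v that by blast
qed

text \<open>Take a nonzero \<open>w = r v\<close> in \<open>N\<close>. Over a field \<open>r\<close>
  can be inverted, so \<open>v\<close> lies in \<open>N\<close>. If \<open>A\<close> is simple,
  commutativity of \<open>R\<close> gives \<open>r (s v) = s w\<close>, so the transporter ideal of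
  \<open>M\<close> into \<open>N\<close> contains the image of \<open>r\<close> and is all of
  \<open>A\<close>.\<close>

lemma simple_module_of_cyclic:
  assumes R: "domain R" and \<phi>: "\<phi> \<in> ring_hom R A" and M: "left_module A M"
    and v: "v \<in> carrier M" "v \<noteq> \<zero>\<^bsub>M\<^esub>"
    and gen: "\<And>w. w \<in> carrier M \<Longrightarrow> \<exists>r \<in> carrier R. w = \<phi> r \<odot>\<^bsub>M\<^esub> v"
    and cases: "field R \<or> simple_ring A"
  shows "simple_module A M"
  unfolding simple_module_def
proof (intro conjI allI impI)
  interpret R: domain R by (rule R)
  interpret M: left_module A M by (rule M)
  note \<phi>_closed = ring_hom_closed[OF \<phi>]
  show "left_module A M" by (rule M)
  show "carrier M \<noteq> {\<zero>\<^bsub>M\<^esub>}" using v by auto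
  fix N assume N: "submodule N A M"
  interpret N: submodule N A M by (rule N)
  have zero: "\<zero>\<^bsub>M\<^esub> \<in> N" using N.one_closed by simp
  have N_sub: "N \<subseteq> carrier M" using N.subset by simp
  show "N = {\<zero>\<^bsub>M\<^esub>} \<or> N = carrier M"
  proof (rule disjCI)
    assume "N \<noteq> carrier M"
    show "N = {\<zero>\<^bsub>M\<^esub>}"
    proof (rule ccontr)
      assume "N \<noteq> {\<zero>\<^bsub>M\<^esub>}"
      then obtain w where w: "w \<in> N" "w \<noteq> \<zero>\<^bsub>M\<^esub>" using zero by auto
      then obtain r where r: "r \<in> carrier R" "w = \<phi> r \<odot>\<^bsub>M\<^esub> v"
        using gen N_sub by blast
      from cases show False
      proof
        assume "field R"
        then interpret F: field R .
        have "r \<noteq> \<zero>\<^bsub>R\<^esub>"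
          using r w v \<phi> M.zero_smult[OF v(1)] ring_hom_zero[OF \<phi> R.ring_axioms M.R.ring_axioms] by auto
        then have rU: "r \<in> Units R" using r F.field_Units by auto
        have "v \<in> N"
        proof -
          have "\<phi> (inv\<^bsub>R\<^esub> r) \<odot>\<^bsub>M\<^esub> w = \<phi> (inv\<^bsub>R\<^esub> r \<otimes>\<^bsub>R\<^esub> r) \<odot>\<^bsub>M\<^esub> v"
            using r rU v by (simp add: ring_hom_mult[OF \<phi>] M.smult_assoc \<phi>_closed del: R.Units_l_inv)
          also have "\<dots> = v"
            using rU v by (simp add: ring_hom_one[OF \<phi>] M.smult_one)
          finally show ?thesis
            using N.smult_closed[of "\<phi> (inv\<^bsub>R\<^esub> r)" w] w rU \<phi>_closed by auto
        qed
        then have "carrier M \<subseteq> N"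
          using gen N.smult_closed \<phi>_closed by blast
        then show False using N_sub \<open>N \<noteq> carrier M\<close> by auto
      next
        assume simple: "simple_ring A"
        let ?I = "{u \<in> carrier A. \<forall>m \<in> carrier M. u \<odot>\<^bsub>M\<^esub> m \<in> N}"
        have "\<phi> r \<odot>\<^bsub>M\<^esub> m \<in> N" if m: "m \<in> carrier M" for m
        proof -
          obtain s where s: "s \<in> carrier R" "m = \<phi> s \<odot>\<^bsub>M\<^esub> v" using gen m by blast
          have "\<phi> r \<odot>\<^bsub>M\<^esub> m = \<phi> (r \<otimes>\<^bsub>R\<^esub> s) \<odot>\<^bsub>M\<^esub> v"
            using r s v by (simp add: ring_hom_mult[OF \<phi>] M.smult_assoc \<phi>_closed)
          also have "r \<otimes>\<^bsub>R\<^esub> s = s \<otimes>\<^bsub>R\<^esub> r" using r s R.m_comm by simp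
          also have "\<phi> (s \<otimes>\<^bsub>R\<^esub> r) \<odot>\<^bsub>M\<^esub> v = \<phi> s \<odot>\<^bsub>M\<^esub> w"
            using r s v by (simp add: ring_hom_mult[OF \<phi>] M.smult_assoc \<phi>_closed)
          finally show ?thesis using s w \<phi>_closed by simp
        qed
        then have "\<phi> r \<in> ?I" using r \<phi>_closed by simp
        moreover have "\<phi> r \<noteq> \<zero>\<^bsub>A\<^esub>" using r w v M.zero_smult by auto
        ultimately have "?I \<noteq> {\<zero>\<^bsub>A\<^esub>}" by blast
        then have I: "?I = carrier A"
          using simple M.transporter_ideal[OF N] unfolding simple_ring_def by blast
        then have "\<one>\<^bsub>A\<^esub> \<in> ?I" by auto
        then have "carrier M \<subseteq> N" using M.smult_one by auto
        then show False using N_sub \<open>N \<noteq> carrier M\<close> by auto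
      qed
    qed
  qed
qed


section \<open>The module given by a factorization of \<open>a\<close>\<close>

text \<open>The action is defined on terms first and passed to classes later. Here
  \<open>inv_into\<close> is the inverse of \<sigma>, and the twists are chosen so that
  \<open>x y\<close> acts as \<open>f h\<close> and \<open>y x\<close> as
  \<open>\<sigma> (f h)\<close>.\<close>

primrec rank_one_action ::
    "('a, 'r) ring_scheme \<Rightarrow> ('a \<Rightarrow> 'a) \<Rightarrow> 'a \<Rightarrow> 'a \<Rightarrow> 'a gwa_term \<Rightarrow> 'a \<Rightarrow> 'a" where
  "rank_one_action R \<sigma> f h (Coeff r) v = r \<otimes>\<^bsub>R\<^esub> v"
| "rank_one_action R \<sigma> f h GenX v = inv_into (carrier R) \<sigma> v \<otimes>\<^bsub>R\<^esub> f"
| "rank_one_action R \<sigma> f h GenY v = \<sigma> v \<otimes>\<^bsub>R\<^esub> \<sigma> h"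
| "rank_one_action R \<sigma> f h (Plus s t) v = rank_one_action R \<sigma> f h s v \<oplus>\<^bsub>R\<^esub> rank_one_action R \<sigma> f h t v"
| "rank_one_action R \<sigma> f h (Minus t) v = \<ominus>\<^bsub>R\<^esub> rank_one_action R \<sigma> f h t v"
| "rank_one_action R \<sigma> f h (Times s t) v = rank_one_action R \<sigma> f h s (rank_one_action R \<sigma> f h t v)"

text \<open>A class acts through an arbitrary representative; \<open>act_rel\<close> makes the
  choice immaterial.\<close>

definition rank_one_module ::
    "('a, 'r) ring_scheme \<Rightarrow> ('a \<Rightarrow> 'a) \<Rightarrow> 'a \<Rightarrow> 'a \<Rightarrow> ('a gwa_term set, 'a) module" where
  "rank_one_module R \<sigma> f h =
    \<lparr>carrier = carrier R, monoid.mult = monoid.mult R, one = one R, zero = zero R, add = add R,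
     smult = (\<lambda>S. rank_one_action R \<sigma> f h (SOME t. t \<in> S))\<rparr>"

locale gwa_domain = R?: domain R for R :: "('a, 'r) ring_scheme" (structure) +
  fixes \<sigma> :: "'a \<Rightarrow> 'a" and a :: 'a
  assumes \<sigma>_iso: "\<sigma> \<in> ring_iso R R" and a_closed [simp]: "a \<in> carrier R"
begin

abbreviation \<tau> :: "'a \<Rightarrow> 'a" where "\<tau> \<equiv> inv_into (carrier R) \<sigma>"

abbreviation A :: "'a gwa_term set ring" where "A \<equiv> gwa R \<sigma> a"

lemma \<tau>_iso: "\<tau> \<in> ring_iso R R"
  by (rule ring_iso_set_sym[OF ring_axioms \<sigma>_iso])

lemma \<sigma>_hom: "\<sigma> \<in> ring_hom R R" and \<tau>_hom: "\<tau> \<in> ring_hom R R"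
  using \<sigma>_iso \<tau>_iso by (simp_all add: ring_iso_def)

lemmas \<sigma>_simps [simp] = ring_hom_closed[OF \<sigma>_hom] ring_hom_add[OF \<sigma>_hom] ring_hom_mult[OF \<sigma>_hom]
  ring_hom_one[OF \<sigma>_hom] ring_hom_zero[OF \<sigma>_hom ring_axioms ring_axioms]

lemmas \<tau>_simps [simp] = ring_hom_closed[OF \<tau>_hom] ring_hom_add[OF \<tau>_hom] ring_hom_mult[OF \<tau>_hom]
  ring_hom_one[OF \<tau>_hom] ring_hom_zero[OF \<tau>_hom ring_axioms ring_axioms]

lemma \<sigma>_bij: "bij_betw \<sigma> (carrier R) (carrier R)"
  using \<sigma>_iso by (simp add: ring_iso_def)

lemma \<sigma>_\<tau> [simp]: "r \<in> carrier R \<Longrightarrow> \<sigma> (\<tau> r) = r"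
  and \<tau>_\<sigma> [simp]: "r \<in> carrier R \<Longrightarrow> \<tau> (\<sigma> r) = r"
  using \<sigma>_bij by (auto simp: bij_betw_def f_inv_into_f)

lemma \<sigma>_eq_iff: "r \<in> carrier R \<Longrightarrow> s \<in> carrier R \<Longrightarrow> \<sigma> r = \<sigma> s \<longleftrightarrow> r = s"
  by (metis \<tau>_\<sigma>)

sublocale A: ring A
  by (rule gwa_ring[OF ring_axioms \<sigma>_hom a_closed])

lemmas gwa_simps = gwa_carrier[OF ring_axioms \<sigma>_hom a_closed]
  gwa_mult[OF ring_axioms \<sigma>_hom a_closed]
  gwa_add[OF ring_axioms \<sigma>_hom a_closed]
  gwa_one[OF ring_axioms \<sigma>_hom a_closed]
  gwa_zero[OF ring_axioms \<sigma>_hom a_closed]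

context
  fixes f h :: 'a
  assumes fh: "f \<in> carrier R" "h \<in> carrier R" "f \<otimes> h = a"
begin

abbreviation act :: "'a gwa_term \<Rightarrow> 'a \<Rightarrow> 'a" where "act \<equiv> rank_one_action R \<sigma> f h"

lemma act_closed [simp]:
  "t \<in> gwa_terms R \<Longrightarrow> v \<in> carrier R \<Longrightarrow> act t v \<in> carrier R"
  by (induction arbitrary: v rule: gwa_terms.induct) (auto simp: fh)

lemma act_add [simp]:
  "t \<in> gwa_terms R \<Longrightarrow> v \<in> carrier R \<Longrightarrow> w \<in> carrier R \<Longrightarrow> act t (v \<oplus> w) = act t v \<oplus> act t w"
proof (induction arbitrary: v w rule: gwa_terms.induct)
  case (Plus s t)
  then show ?case by (simp add: a_ac)
qed (auto simp: fh r_distr l_distr R.minus_add)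

text \<open>Well-definedness on classes. The relations \<open>rel_xy\<close> and
  \<open>rel_yx\<close> are where the factorization \<open>f \<otimes> h = a\<close> enters.\<close>

lemma act_rel:
  "(s, t) \<in> gwa_rel R \<sigma> a \<Longrightarrow> v \<in> carrier R \<Longrightarrow> act s v = act t v"
proof (induction arbitrary: v rule: gwa_rel.induct)
  \<comment> \<open>The induction hypothesis for \<open>s\<close> is applied at the vector
    \<open>act t' v\<close>, which must lie in the carrier; hence \<open>t'\<close> has to be a
    term.\<close>
  case (cong_Times s s' t t')
  then have "t' \<in> gwa_terms R"
    using gwa_rel_terms[OF ring_axioms \<sigma>_hom a_closed] by blast
  with cong_Times show ?case by simp
next
  case (rel_x r)
  then show ?case by (simp add: fh m_assoc)
next
  case (rel_y r)
  then show ?case by (simp add: fh m_assoc)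
next
  case rel_xy
  then show ?case by (simp add: fh(1,2) fh(3)[symmetric] m_comm m_lcomm m_assoc)
next
  case rel_yx
  then show ?case by (simp add: fh(1,2) fh(3)[symmetric] m_comm m_lcomm m_assoc)
qed (auto simp: a_assoc m_assoc l_neg l_distr intro: a_comm)

lemma rank_one_smult:
  assumes t: "t \<in> gwa_terms R" and v: "v \<in> carrier R"
  shows "gwa_class R \<sigma> a t \<odot>\<^bsub>rank_one_module R \<sigma> f h\<^esub> v = act t v"
proof -
  let ?S = "gwa_class R \<sigma> a t"
  have "t \<in> ?S" using t by (simp add: gwa_class_def gwa_rel.refl)
  then have "(SOME t. t \<in> ?S) \<in> ?S" by (rule someI)
  then have "(t, SOME t. t \<in> ?S) \<in> gwa_rel R \<sigma> a" by (simp add: gwa_class_def)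
  from act_rel[OF this v] show ?thesis by (simp add: rank_one_module_def)
qed

lemma rank_one_carrier: "carrier (rank_one_module R \<sigma> f h) = carrier R"
  and rank_one_add: "add (rank_one_module R \<sigma> f h) = add R"
  and rank_one_zero: "zero (rank_one_module R \<sigma> f h) = \<zero>"
  by (simp_all add: rank_one_module_def)

lemma left_module_rank_one: "left_module A (rank_one_module R \<sigma> f h)"
proof (intro left_module.intro left_module_axioms.intro)
  show "ring A" by (rule A.ring_axioms)
  show "abelian_group (rank_one_module R \<sigma> f h)"
  proof (rule abelian_groupI)
    fix x assume "x \<in> carrier (rank_one_module R \<sigma> f h)"
    then show "\<exists>y\<in>carrier (rank_one_module R \<sigma> f h). y \<oplus>\<^bsub>rank_one_module R \<sigma> f h\<^esub> x = \<zero>\<^bsub>rank_one_module R \<sigma> f h\<^esub>"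
      by (auto simp: rank_one_carrier rank_one_add rank_one_zero l_neg intro!: bexI[of _ "\<ominus> x"])
  qed (auto simp: rank_one_carrier rank_one_add rank_one_zero a_assoc intro: a_comm)
qed (auto simp: rank_one_carrier rank_one_add gwa_simps rank_one_smult gwa_terms.intros)

text \<open>Elements of \<open>R\<close> act by multiplication, so {1} is a basis and the coordinate
  of a vector is the vector itself.\<close>

lemma free_of_rank_rank_one:
  "free_of_rank R 1 (restrict_scalars (gwa_coeff R \<sigma> a) (rank_one_module R \<sigma> f h))"
proof -
  let ?M = "restrict_scalars (gwa_coeff R \<sigma> a) (rank_one_module R \<sigma> f h)"
  have simps: "carrier ?M = carrier R" "add ?M = add R" "zero ?M = \<zero>"
    by (simp_all add: restrict_scalars_def rank_one_module_def)
  interpret M: abelian_monoid ?M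
    by (rule abelian_monoidI) (auto simp: simps a_assoc intro: a_comm)
  have smult: "r \<odot>\<^bsub>?M\<^esub> v = r \<otimes> v" if "r \<in> carrier R" "v \<in> carrier R" for r v
    using that rank_one_smult[of "Coeff r" v]
    by (simp add: restrict_scalars_def gwa_coeff_def gwa_terms.Coeff)
  have sum: "(\<Oplus>\<^bsub>?M\<^esub>b\<in>{\<one>}. c b \<odot>\<^bsub>?M\<^esub> b) = c \<one>" if "c \<in> {\<one>} \<rightarrow>\<^sub>E carrier R" for c
  proof -
    have "c \<one> \<in> carrier R" using that by auto
    then show ?thesis by (subst M.finsum_insert) (simp_all only: M.finsum_empty, auto simp: simps smult)
  qed
  show ?thesis
    unfolding free_of_rank_def
  proof (intro exI conjI ballI)
    fix v assume v: "v \<in> carrier ?M"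
    show "\<exists>!c. c \<in> {\<one>} \<rightarrow>\<^sub>E carrier R \<and> v = (\<Oplus>\<^bsub>?M\<^esub>b\<in>{\<one>}. c b \<odot>\<^bsub>?M\<^esub> b)"
    proof (rule ex1I)
      have c: "(\<lambda>b\<in>{\<one>}. v) \<in> {\<one>} \<rightarrow>\<^sub>E carrier R" using v by (auto simp: simps)
      show "(\<lambda>b\<in>{\<one>}. v) \<in> {\<one>} \<rightarrow>\<^sub>E carrier R \<and> v = (\<Oplus>\<^bsub>?M\<^esub>b\<in>{\<one>}. (\<lambda>b\<in>{\<one>}. v) b \<odot>\<^bsub>?M\<^esub> b)"
        unfolding sum[OF c] using c by simp
      fix c assume c: "c \<in> {\<one>} \<rightarrow>\<^sub>E carrier R \<and> v = (\<Oplus>\<^bsub>?M\<^esub>b\<in>{\<one>}. c b \<odot>\<^bsub>?M\<^esub> b)"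
      then have "v = c \<one>" using sum[of c] by simp
      then show "c = (\<lambda>b\<in>{\<one>}. v)"
        using c by (intro extensionalityI[of _ "{\<one>}"]) (auto simp: PiE_def)
    qed
  qed (auto simp: simps)
qed

text \<open>Stability under \<open>x\<close> is phrased at \<open>r\<close> with
  \<open>\<sigma> r\<close> in \<open>K\<close>, that is at \<open>r = \<tau> k\<close>, which keeps
  the inverse automorphism out of the hypotheses.\<close>

lemma submodule_rank_one:
  assumes K: "ideal K R"
    and x: "\<And>r. r \<in> carrier R \<Longrightarrow> \<sigma> r \<in> K \<Longrightarrow> r \<otimes> f \<in> K"
    and y: "\<And>r. r \<in> K \<Longrightarrow> \<sigma> r \<otimes> \<sigma> h \<in> K"
  shows "submodule K A (rank_one_module R \<sigma> f h)"
proof (intro submodule.intro submodule_axioms.intro)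
  interpret K: ideal K R by (rule K)
  interpret M: left_module A "rank_one_module R \<sigma> f h" by (rule left_module_rank_one)
  have inv: "\<ominus>\<^bsub>rank_one_module R \<sigma> f h\<^esub> k \<in> K" if "k \<in> K" for k
  proof -
    have "\<ominus>\<^bsub>rank_one_module R \<sigma> f h\<^esub> k = \<ominus> k"
      using that K.Icarr[of k] by (intro M.minus_equality) (auto simp: rank_one_carrier rank_one_add rank_one_zero l_neg)
    then show ?thesis using that K.a_inv_closed by simp
  qed
  show "subgroup K (add_monoid (rank_one_module R \<sigma> f h))"
  proof (rule M.M.add.subgroupI)
    show "K \<subseteq> carrier (rank_one_module R \<sigma> f h)"
      using K.Icarr by (auto simp: rank_one_carrier)
    show "K \<noteq> {}" using K.zero_closed by blast
  qed (use inv K.a_closed in \<open>simp_all add: rank_one_add\<close>)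
  have act: "act t k \<in> K" if "t \<in> gwa_terms R" "k \<in> K" for t k
    using that
  proof (induction arbitrary: k rule: gwa_terms.induct)
    case GenX
    then show ?case using x[of "\<tau> k"] K.Icarr by simp
  qed (auto simp: K.I_l_closed y K.a_closed)
  show "u \<odot>\<^bsub>rank_one_module R \<sigma> f h\<^esub> k \<in> K" if "u \<in> carrier A" "k \<in> K" for u k
    using that act K.Icarr by (auto simp: gwa_simps rank_one_smult)
qed

end

end


section \<open>Normal forms\<close>

text \<open>Keeps powers with exponent \<open>nat i\<close> as natural powers, the form in which
  \<open>monomial\<close> is defined.\<close>

declare pow_nat [simp del]

context gwa_domain
begin

section \<open>Powers of \<sigma> with integer exponent\<close>

lemma \<sigma>_pow_iso: "\<sigma> ^^ n \<in> ring_iso R R" and \<tau>_pow_iso: "\<tau> ^^ n \<in> ring_iso R R"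
proof -
  have "\<phi> ^^ n \<in> ring_iso R R" if "\<phi> \<in> ring_iso R R" for \<phi>
  proof (induction n)
    case 0
    then show ?case by (auto simp: ring_iso_def ring_hom_def bij_betw_def)
  next
    case (Suc n)
    then show ?case using ring_iso_set_trans[OF Suc that] by (simp add: comp_def)
  qed
  then show "\<sigma> ^^ n \<in> ring_iso R R" "\<tau> ^^ n \<in> ring_iso R R"
    using \<sigma>_iso \<tau>_iso by auto
qed

lemma ring_iso_closed: "\<phi> \<in> ring_iso R R \<Longrightarrow> r \<in> carrier R \<Longrightarrow> \<phi> r \<in> carrier R"
  by (rule ring_iso_memE(1))

lemma ring_iso_eq_zero_iff:
  assumes "\<phi> \<in> ring_iso R R" "r \<in> carrier R"
  shows "\<phi> r = \<zero> \<longleftrightarrow> r = \<zero>"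
proof -
  have "\<phi> \<zero> = \<zero>"
    using assms by (intro ring_hom_zero[OF _ ring_axioms ring_axioms]) (simp add: ring_iso_def)
  moreover have "inj_on \<phi> (carrier R)"
    using assms by (simp add: ring_iso_def bij_betw_def)
  ultimately show ?thesis
    using assms(2) by (metis R.zero_closed inj_onD)
qed

lemmas \<sigma>_pow_closed [simp] = ring_iso_closed[OF \<sigma>_pow_iso]
  and \<tau>_pow_closed [simp] = ring_iso_closed[OF \<tau>_pow_iso]

lemma \<sigma>_\<tau>_pow [simp]: "r \<in> carrier R \<Longrightarrow> (\<sigma> ^^ n) ((\<tau> ^^ n) r) = r"
proof (induction n arbitrary: r)
  case (Suc n)
  have "(\<sigma> ^^ Suc n) ((\<tau> ^^ Suc n) r) = (\<sigma> ^^ n) (\<sigma> (\<tau> ((\<tau> ^^ n) r)))"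
    by (simp add: funpow_swap1)
  then show ?case using Suc by simp
qed simp

lemma \<tau>_\<sigma>_pow [simp]: "r \<in> carrier R \<Longrightarrow> (\<tau> ^^ n) ((\<sigma> ^^ n) r) = r"
proof (induction n arbitrary: r)
  case (Suc n)
  have "(\<tau> ^^ Suc n) ((\<sigma> ^^ Suc n) r) = (\<tau> ^^ n) (\<tau> (\<sigma> ((\<sigma> ^^ n) r)))"
    by (simp add: funpow_swap1)
  then show ?case using Suc by simp
qed simp

text \<open>The twist that a scalar undergoes when the monomial of degree \<open>i\<close> moves
  past it.\<close>

definition \<sigma>_int :: "int \<Rightarrow> 'a \<Rightarrow> 'a" where
  "\<sigma>_int i = (if 0 \<le> i then \<sigma> ^^ nat i else \<tau> ^^ nat (- i))"

lemma \<sigma>_int_iso: "\<sigma>_int i \<in> ring_iso R R"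
  by (simp add: \<sigma>_int_def \<sigma>_pow_iso \<tau>_pow_iso)

lemmas \<sigma>_int_closed [simp] = ring_iso_closed[OF \<sigma>_int_iso]

text \<open>Composing with a large enough power of \<sigma> clears a negative exponent, so integer
  powers can be compared as natural ones.\<close>

lemma \<sigma>_int_shift:
  assumes r: "r \<in> carrier R" and i: "0 \<le> int m + i"
  shows "\<sigma>_int i ((\<sigma> ^^ m) r) = (\<sigma> ^^ nat (int m + i)) r"
proof (cases "0 \<le> i")
  case True
  then have "nat (int m + i) = nat i + m" by simp
  then show ?thesis using True by (simp add: \<sigma>_int_def funpow_add)
next
  case False
  then have "m = nat (- i) + nat (int m + i)" using i by simp
  then have "(\<sigma> ^^ m) r = (\<sigma> ^^ nat (- i)) ((\<sigma> ^^ nat (int m + i)) r)"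
    by (metis comp_apply funpow_add)
  then show ?thesis using False r by (simp add: \<sigma>_int_def)
qed

text \<open>For \<open>i \<le> j\<close>, shifting by \<bar>i\<bar> turns both sides into natural
  powers of \<sigma>. Cancelling the smaller one would leave a positive power of \<sigma> equal to
  the identity.\<close>

lemma \<sigma>_int_faithful:
  assumes inf: "\<And>n. n > 0 \<Longrightarrow> \<exists>r \<in> carrier R. (\<sigma> ^^ n) r \<noteq> r"
    and eq: "\<And>r. r \<in> carrier R \<Longrightarrow> \<sigma>_int i r = \<sigma>_int j r"
  shows "i = j"
  using eq
proof (induction i j rule: linorder_wlog)
  case (le i j)
  define m where "m = nat \<bar>i\<bar>"
  show ?case
  proof (rule ccontr)
    assume "i \<noteq> j"
    then have "0 < nat (j - i)" using le by simp
    then obtain r where r: "r \<in> carrier R" "(\<sigma> ^^ nat (j - i)) r \<noteq> r" using inf by blast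
    let ?k = "nat (int m + i)"
    have "(\<sigma> ^^ ?k) ((\<sigma> ^^ nat (j - i)) r) = (\<sigma> ^^ (?k + nat (j - i))) r"
      by (simp add: funpow_add)
    also have "?k + nat (j - i) = nat (int m + j)" using le by (simp add: m_def)
    also have "(\<sigma> ^^ nat (int m + j)) r = (\<sigma> ^^ ?k) r"
      using le(2)[of "(\<sigma> ^^ m) r"] r \<sigma>_int_shift[of r m i] \<sigma>_int_shift[of r m j] le(1)
      by (simp add: m_def)
    finally have "(\<tau> ^^ ?k) ((\<sigma> ^^ ?k) ((\<sigma> ^^ nat (j - i)) r)) = (\<tau> ^^ ?k) ((\<sigma> ^^ ?k) r)"
      by simp
    then show False using r by simp
  qed
next
  case (sym i j)
  then show ?case by metis
qed

section \<open>Commutation rules for scalars, \<open>X\<close> and \<open>Y\<close>\<close>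

abbreviation c :: "'a \<Rightarrow> 'a gwa_term set" where "c \<equiv> gwa_coeff R \<sigma> a"

definition X :: "'a gwa_term set" where "X = gwa_class R \<sigma> a GenX"

definition Y :: "'a gwa_term set" where "Y = gwa_class R \<sigma> a GenY"

lemmas c_hom = gwa_coeff_hom[OF ring_axioms \<sigma>_hom a_closed]

lemmas c_simps [simp] = ring_hom_closed[OF c_hom] ring_hom_one[OF c_hom]
  ring_hom_zero[OF c_hom ring_axioms A.ring_axioms]

lemma c_uminus: "r \<in> carrier R \<Longrightarrow> c (\<ominus> r) = \<ominus>\<^bsub>A\<^esub> c r"
  by (rule A.minus_equality[symmetric]) (simp_all add: l_neg flip: ring_hom_add[OF c_hom])

lemma X_closed [simp]: "X \<in> carrier A" and Y_closed [simp]: "Y \<in> carrier A"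
  by (simp_all add: X_def Y_def gwa_simps gwa_terms.intros)

lemma X_c:
  assumes "r \<in> carrier R"
  shows "X \<otimes>\<^bsub>A\<^esub> c r = c (\<tau> r) \<otimes>\<^bsub>A\<^esub> X"
  using assms gwa_class_eqI[OF ring_axioms \<sigma>_hom a_closed gwa_rel.rel_x[where r = "\<tau> r" and R = R and \<sigma> = \<sigma> and a = a]]
  by (simp add: X_def gwa_coeff_def gwa_simps gwa_terms.intros)

lemma Y_c:
  assumes "r \<in> carrier R"
  shows "Y \<otimes>\<^bsub>A\<^esub> c r = c (\<sigma> r) \<otimes>\<^bsub>A\<^esub> Y"
  using assms gwa_class_eqI[OF ring_axioms \<sigma>_hom a_closed gwa_rel.rel_y[where r = r and R = R and \<sigma> = \<sigma> and a = a]]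
  by (simp add: Y_def gwa_coeff_def gwa_simps gwa_terms.intros)

lemma X_Y: "X \<otimes>\<^bsub>A\<^esub> Y = c a"
  using gwa_class_eqI[OF ring_axioms \<sigma>_hom a_closed gwa_rel.rel_xy[where R = R and \<sigma> = \<sigma> and a = a]]
  by (simp add: X_def Y_def gwa_coeff_def gwa_simps gwa_terms.intros)

lemma Y_X: "Y \<otimes>\<^bsub>A\<^esub> X = c (\<sigma> a)"
  using gwa_class_eqI[OF ring_axioms \<sigma>_hom a_closed gwa_rel.rel_yx[where R = R and \<sigma> = \<sigma> and a = a]]
  by (simp add: X_def Y_def gwa_coeff_def gwa_simps gwa_terms.intros)

text \<open>Stated for any element that twists scalars by an automorphism, so as to serve both
  \<open>Y\<close> with \<sigma> and \<open>X\<close> with its inverse.\<close>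

lemma skew_pow:
  assumes z: "z \<in> carrier A" and \<phi>: "\<phi> \<in> ring_iso R R"
    and comm: "\<And>r. r \<in> carrier R \<Longrightarrow> z \<otimes>\<^bsub>A\<^esub> c r = c (\<phi> r) \<otimes>\<^bsub>A\<^esub> z"
    and r: "r \<in> carrier R"
  shows "z [^]\<^bsub>A\<^esub> (n::nat) \<otimes>\<^bsub>A\<^esub> c r = c ((\<phi> ^^ n) r) \<otimes>\<^bsub>A\<^esub> z [^]\<^bsub>A\<^esub> n"
  using r
proof (induction n arbitrary: r)
  case (Suc n)
  have \<phi>r: "\<phi> r \<in> carrier R" using ring_iso_closed[OF \<phi> Suc(2)] .
  have \<phi>nr: "(\<phi> ^^ n) (\<phi> r) \<in> carrier R"
    using \<phi>r by (induction n) (auto intro: ring_iso_closed[OF \<phi>])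
  have "z [^]\<^bsub>A\<^esub> Suc n \<otimes>\<^bsub>A\<^esub> c r = z [^]\<^bsub>A\<^esub> n \<otimes>\<^bsub>A\<^esub> c (\<phi> r) \<otimes>\<^bsub>A\<^esub> z"
    using Suc(2) z \<phi>r by (simp add: A.m_assoc comm)
  also have "\<dots> = c ((\<phi> ^^ n) (\<phi> r)) \<otimes>\<^bsub>A\<^esub> z [^]\<^bsub>A\<^esub> n \<otimes>\<^bsub>A\<^esub> z"
    using Suc(1)[OF \<phi>r] by simp
  also have "\<dots> = c ((\<phi> ^^ Suc n) r) \<otimes>\<^bsub>A\<^esub> z [^]\<^bsub>A\<^esub> Suc n"
    using z \<phi>nr by (simp add: A.m_assoc funpow_swap1)
  finally show ?case .
qed (use z in simp)

text \<open>The inner pair \<open>z w = b\<close> moves out to the left past \<open>z^n\<close> and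
  becomes \<open>\<phi>^n(b)\<close>. The result is a product of images of \<open>b\<close>, nonzero
  in a domain.\<close>

lemma skew_pow_mult_pow:
  assumes z: "z \<in> carrier A" and w: "w \<in> carrier A" and \<phi>: "\<phi> \<in> ring_iso R R"
    and comm: "\<And>r. r \<in> carrier R \<Longrightarrow> z \<otimes>\<^bsub>A\<^esub> c r = c (\<phi> r) \<otimes>\<^bsub>A\<^esub> z"
    and zw: "z \<otimes>\<^bsub>A\<^esub> w = c b" and b: "b \<in> carrier R" "b \<noteq> \<zero>"
  shows "\<exists>d \<in> carrier R - {\<zero>}. z [^]\<^bsub>A\<^esub> (n::nat) \<otimes>\<^bsub>A\<^esub> w [^]\<^bsub>A\<^esub> n = c d"
proof (induction n)
  case 0
  then show ?case by (auto intro: bexI[of _ \<one>])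
next
  case (Suc n)
  then obtain d where d: "d \<in> carrier R - {\<zero>}" "z [^]\<^bsub>A\<^esub> n \<otimes>\<^bsub>A\<^esub> w [^]\<^bsub>A\<^esub> n = c d" by blast
  have \<phi>nb: "(\<phi> ^^ n) b \<in> carrier R - {\<zero>}"
    using b by (induction n) (auto simp: ring_iso_eq_zero_iff[OF \<phi>] intro: ring_iso_closed[OF \<phi>])
  have "z [^]\<^bsub>A\<^esub> Suc n \<otimes>\<^bsub>A\<^esub> w [^]\<^bsub>A\<^esub> Suc n = z [^]\<^bsub>A\<^esub> n \<otimes>\<^bsub>A\<^esub> (z \<otimes>\<^bsub>A\<^esub> w) \<otimes>\<^bsub>A\<^esub> w [^]\<^bsub>A\<^esub> n"
    using z w by (subst A.nat_pow_Suc2[of w]) (simp_all add: A.m_assoc)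
  also have "\<dots> = c ((\<phi> ^^ n) b) \<otimes>\<^bsub>A\<^esub> c d"
    using z w b \<phi>nb d(2) by (simp add: zw skew_pow[OF z \<phi> comm] A.m_assoc)
  also have "\<dots> = c ((\<phi> ^^ n) b \<otimes> d)"
    using \<phi>nb d by (simp add: ring_hom_mult[OF c_hom])
  finally show ?case
    using \<phi>nb d by (intro bexI[of _ "(\<phi> ^^ n) b \<otimes> d"]) (auto simp: integral_iff)
qed

lemmas Y_pow_c = skew_pow[OF Y_closed \<sigma>_iso Y_c]
  and X_pow_c = skew_pow[OF X_closed \<tau>_iso X_c]

text \<open>Degree \<open>i\<close> in the grading in which \<open>Y\<close> has degree 1 and
  \<open>X\<close> has degree -1.\<close>

definition monomial :: "int \<Rightarrow> 'a gwa_term set" where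
  "monomial i = (if 0 \<le> i then Y [^]\<^bsub>A\<^esub> nat i else X [^]\<^bsub>A\<^esub> nat (- i))"

lemma monomial_closed [simp]: "monomial i \<in> carrier A"
  by (simp add: monomial_def)

lemma monomial_c: "r \<in> carrier R \<Longrightarrow> monomial i \<otimes>\<^bsub>A\<^esub> c r = c (\<sigma>_int i r) \<otimes>\<^bsub>A\<^esub> monomial i"
  by (simp add: monomial_def \<sigma>_int_def X_pow_c Y_pow_c)

text \<open>In positive degree \<open>X\<close> meets a factor \<open>Y\<close> and leaves the
  coefficient \<open>a\<close>; otherwise the power of \<open>X\<close> grows and the coefficient is
  1.\<close>

lemma X_monomial: "\<exists>b \<in> carrier R. X \<otimes>\<^bsub>A\<^esub> monomial i = c b \<otimes>\<^bsub>A\<^esub> monomial (i - 1)"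
proof (cases "0 < i")
  case True
  then have "nat i = Suc (nat (i - 1))" by simp
  moreover have "monomial i = Y [^]\<^bsub>A\<^esub> nat i" "monomial (i - 1) = Y [^]\<^bsub>A\<^esub> nat (i - 1)"
    using True by (simp_all add: monomial_def)
  ultimately have "monomial i = Y \<otimes>\<^bsub>A\<^esub> monomial (i - 1)"
    by (simp only: A.nat_pow_Suc2[OF Y_closed])
  then have "X \<otimes>\<^bsub>A\<^esub> monomial i = c a \<otimes>\<^bsub>A\<^esub> monomial (i - 1)"
    by (simp add: X_Y flip: A.m_assoc)
  then show ?thesis by auto
next
  case False
  then have "nat (- (i - 1)) = Suc (nat (- i))" by simp
  moreover have "monomial i = X [^]\<^bsub>A\<^esub> nat (- i)" using False by (auto simp: monomial_def)
  ultimately have "X \<otimes>\<^bsub>A\<^esub> monomial i = c \<one> \<otimes>\<^bsub>A\<^esub> monomial (i - 1)"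
    using False A.nat_pow_Suc2[OF X_closed, of "nat (- i)"] by (simp add: monomial_def[of "i - 1"])
  then show ?thesis by blast
qed

lemma Y_monomial: "\<exists>b \<in> carrier R. Y \<otimes>\<^bsub>A\<^esub> monomial i = c b \<otimes>\<^bsub>A\<^esub> monomial (i + 1)"
proof (cases "i < 0")
  case True
  then have "nat (- i) = Suc (nat (- (i + 1)))" by simp
  moreover have "monomial i = X [^]\<^bsub>A\<^esub> nat (- i)"
    "monomial (i + 1) = X [^]\<^bsub>A\<^esub> nat (- (i + 1))"
    using True by (auto simp: monomial_def)
  ultimately have "monomial i = X \<otimes>\<^bsub>A\<^esub> monomial (i + 1)"
    by (simp only: A.nat_pow_Suc2[OF X_closed])
  then have "Y \<otimes>\<^bsub>A\<^esub> monomial i = c (\<sigma> a) \<otimes>\<^bsub>A\<^esub> monomial (i + 1)"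
    by (simp add: Y_X flip: A.m_assoc)
  then show ?thesis by auto
next
  case False
  then have "nat (i + 1) = Suc (nat i)" by simp
  then have "Y \<otimes>\<^bsub>A\<^esub> monomial i = c \<one> \<otimes>\<^bsub>A\<^esub> monomial (i + 1)"
    using False A.nat_pow_Suc2[OF Y_closed, of "nat i"] by (simp add: monomial_def)
  then show ?thesis by blast
qed

text \<open>Used to get from a single term of an ideal back to a nonzero scalar.\<close>

lemma monomial_mult_monomial_uminus:
  assumes "a \<noteq> \<zero>"
  shows "\<exists>d \<in> carrier R - {\<zero>}. monomial i \<otimes>\<^bsub>A\<^esub> monomial (- i) = c d"
proof (cases "0 \<le> i")
  case True
  then have "monomial i = Y [^]\<^bsub>A\<^esub> nat i" "monomial (- i) = X [^]\<^bsub>A\<^esub> nat i" by (auto simp: monomial_def)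
  moreover have "\<sigma> a \<noteq> \<zero>" using assms ring_iso_eq_zero_iff[OF \<sigma>_iso] by simp
  ultimately show ?thesis
    using skew_pow_mult_pow[OF Y_closed X_closed \<sigma>_iso Y_c Y_X] by simp
next
  case False
  then have "monomial i = X [^]\<^bsub>A\<^esub> nat (- i)" "monomial (- i) = Y [^]\<^bsub>A\<^esub> nat (- i)" by (auto simp: monomial_def)
  then show ?thesis
    using assms skew_pow_mult_pow[OF X_closed Y_closed \<tau>_iso X_c X_Y] by simp
qed

section \<open>Finite combinations of monomials exhaust the algebra\<close>

definition comb :: "int set \<Rightarrow> (int \<Rightarrow> 'a) \<Rightarrow> 'a gwa_term set" where
  "comb F p = (\<Oplus>\<^bsub>A\<^esub>i\<in>F. c (p i) \<otimes>\<^bsub>A\<^esub> monomial i)"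

lemma comb_closed [simp]: "p \<in> F \<rightarrow> carrier R \<Longrightarrow> comb F p \<in> carrier A"
  unfolding comb_def by (rule A.finsum_closed) (auto simp: Pi_iff)

lemma comb_mono_neutral:
  assumes "finite G" "F \<subseteq> G" "p \<in> G \<rightarrow> carrier R" "\<And>i. i \<in> G - F \<Longrightarrow> p i = \<zero>"
  shows "comb F p = comb G p"
  unfolding comb_def using assms by (intro A.add.finprod_mono_neutral_cong_left) (auto simp: Pi_iff)

lemma comb_cong:
  assumes "\<And>i. i \<in> F \<Longrightarrow> p i = q i" "q \<in> F \<rightarrow> carrier R"
  shows "comb F p = comb F q"
  unfolding comb_def using assms by (intro A.finsum_cong') (auto simp: Pi_iff)

lemma comb_add:
  assumes "p \<in> F \<rightarrow> carrier R" "q \<in> F \<rightarrow> carrier R"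
  shows "comb F p \<oplus>\<^bsub>A\<^esub> comb F q = comb F (\<lambda>i. p i \<oplus> q i)"
proof -
  have "comb F (\<lambda>i. p i \<oplus> q i) = (\<Oplus>\<^bsub>A\<^esub>i\<in>F. c (p i) \<otimes>\<^bsub>A\<^esub> monomial i \<oplus>\<^bsub>A\<^esub> c (q i) \<otimes>\<^bsub>A\<^esub> monomial i)"
    unfolding comb_def using assms
    by (intro A.finsum_cong') (auto simp: ring_hom_add[OF c_hom] A.l_distr Pi_iff)
  also have "\<dots> = comb F p \<oplus>\<^bsub>A\<^esub> comb F q"
    unfolding comb_def using assms by (intro A.finsum_addf) (auto simp: Pi_iff)
  finally show ?thesis by simp
qed

lemma c_comb:
  assumes "finite F" "r \<in> carrier R" "p \<in> F \<rightarrow> carrier R"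
  shows "c r \<otimes>\<^bsub>A\<^esub> comb F p = comb F (\<lambda>i. r \<otimes> p i)"
proof -
  have "c r \<otimes>\<^bsub>A\<^esub> comb F p = (\<Oplus>\<^bsub>A\<^esub>i\<in>F. c r \<otimes>\<^bsub>A\<^esub> (c (p i) \<otimes>\<^bsub>A\<^esub> monomial i))"
    unfolding comb_def using assms by (intro A.finsum_rdistr) (auto simp: Pi_iff)
  also have "\<dots> = comb F (\<lambda>i. r \<otimes> p i)"
    unfolding comb_def using assms
    by (intro A.finsum_cong') (auto simp: ring_hom_mult[OF c_hom] A.m_assoc Pi_iff)
  finally show ?thesis .
qed

lemma comb_c:
  assumes "finite F" "r \<in> carrier R" "p \<in> F \<rightarrow> carrier R"
  shows "comb F p \<otimes>\<^bsub>A\<^esub> c r = comb F (\<lambda>i. p i \<otimes> \<sigma>_int i r)"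
proof -
  have "comb F p \<otimes>\<^bsub>A\<^esub> c r = (\<Oplus>\<^bsub>A\<^esub>i\<in>F. c (p i) \<otimes>\<^bsub>A\<^esub> monomial i \<otimes>\<^bsub>A\<^esub> c r)"
    unfolding comb_def using assms by (intro A.finsum_ldistr) (auto simp: Pi_iff)
  also have "\<dots> = comb F (\<lambda>i. p i \<otimes> \<sigma>_int i r)"
    unfolding comb_def using assms
    by (intro A.finsum_cong') (auto simp: ring_hom_mult[OF c_hom] A.m_assoc monomial_c Pi_iff)
  finally show ?thesis .
qed

definition combs :: "'a gwa_term set set" where
  "combs = {comb F p |F p. finite F \<and> p \<in> F \<rightarrow> carrier R}"

lemma combs_monomial: "r \<in> carrier R \<Longrightarrow> c r \<otimes>\<^bsub>A\<^esub> monomial i \<in> combs"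
  unfolding combs_def
  by (auto intro!: exI[of _ "{i}"] exI[of _ "\<lambda>_. r"] simp: comb_def A.finsum_insert)

lemma combs_add:
  assumes "u \<in> combs" "w \<in> combs"
  shows "u \<oplus>\<^bsub>A\<^esub> w \<in> combs"
proof -
  obtain F p where F: "finite F" "p \<in> F \<rightarrow> carrier R" "u = comb F p"
    using assms(1) by (auto simp: combs_def)
  obtain G q where G: "finite G" "q \<in> G \<rightarrow> carrier R" "w = comb G q"
    using assms(2) by (auto simp: combs_def)
  \<comment> \<open>Both families are extended by zero to the common index set.\<close>
  let ?p = "\<lambda>i. if i \<in> F then p i else \<zero>" and ?q = "\<lambda>i. if i \<in> G then q i else \<zero>"
  have "u = comb F ?p" using F by (auto intro!: comb_cong)
  also have "\<dots> = comb (F \<union> G) ?p" using F G by (intro comb_mono_neutral) auto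
  finally have u: "u = comb (F \<union> G) ?p" .
  have "w = comb G ?q" using G by (auto intro!: comb_cong)
  also have "\<dots> = comb (F \<union> G) ?q" using F G by (intro comb_mono_neutral) auto
  finally have w: "w = comb (F \<union> G) ?q" .
  have "u \<oplus>\<^bsub>A\<^esub> w = comb (F \<union> G) (\<lambda>i. ?p i \<oplus> ?q i)"
    unfolding u w using F G by (intro comb_add) auto
  moreover have "(\<lambda>i. ?p i \<oplus> ?q i) \<in> F \<union> G \<rightarrow> carrier R"
    using F G by (auto simp: Pi_iff)
  ultimately show ?thesis
    using F G unfolding combs_def by blast
qed

text \<open>Distributivity reduces a left multiplier to its effect on single terms; it is applied to
  \<open>X\<close> and \<open>Y\<close>.\<close>

lemma combs_mult:
  assumes z: "z \<in> carrier A"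
    and monomial: "\<And>r i. r \<in> carrier R \<Longrightarrow> z \<otimes>\<^bsub>A\<^esub> (c r \<otimes>\<^bsub>A\<^esub> monomial i) \<in> combs"
    and u: "u \<in> combs"
  shows "z \<otimes>\<^bsub>A\<^esub> u \<in> combs"
proof -
  obtain F p where F: "finite F" "p \<in> F \<rightarrow> carrier R" "u = comb F p"
    using u by (auto simp: combs_def)
  have "z \<otimes>\<^bsub>A\<^esub> comb F p \<in> combs"
    using F(1,2)
  proof (induction F)
    case empty
    have "comb {} p \<in> combs" by (force simp: combs_def)
    then show ?case using z by (simp add: comb_def)
  next
    case (insert i F)
    then have "comb (insert i F) p = c (p i) \<otimes>\<^bsub>A\<^esub> monomial i \<oplus>\<^bsub>A\<^esub> comb F p"
      unfolding comb_def by (intro A.finsum_insert) (auto simp: Pi_iff)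
    with insert z show ?case
      by (auto simp: A.r_distr intro!: combs_add monomial)
  qed
  then show ?thesis using F by simp
qed

text \<open>The combinations contain 1 and are stable under left multiplication by every term class.
  This gives existence of an expansion, not its uniqueness.\<close>

lemma combs_eq_carrier: "combs = carrier A"
proof
  show "combs \<subseteq> carrier A" by (auto simp: combs_def)
  have c: "c r \<otimes>\<^bsub>A\<^esub> u \<in> combs" if "r \<in> carrier R" "u \<in> combs" for r u
    using that c_comb unfolding combs_def by (fastforce simp: Pi_iff)
  have sub: "combs \<subseteq> carrier A" by (auto simp: combs_def)
  \<comment> \<open>The multiplicand \<open>u\<close> stays arbitrary in the induction on the
    multiplier: in the case \<open>Times s t\<close> the hypothesis for \<open>s\<close> is applied
    to the product of \<open>t\<close> with \<open>u\<close>.\<close>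
  have terms: "gwa_class R \<sigma> a t \<otimes>\<^bsub>A\<^esub> u \<in> combs" if "t \<in> gwa_terms R" "u \<in> combs" for t u
    using that
  proof (induction arbitrary: u rule: gwa_terms.induct)
    case (Coeff r)
    then show ?case using c by (simp add: gwa_coeff_def)
  next
    case GenX
    have "X \<otimes>\<^bsub>A\<^esub> (c r \<otimes>\<^bsub>A\<^esub> monomial i) \<in> combs" if r: "r \<in> carrier R" for r i
    proof -
      have "X \<otimes>\<^bsub>A\<^esub> (c r \<otimes>\<^bsub>A\<^esub> monomial i) = c (\<tau> r) \<otimes>\<^bsub>A\<^esub> (X \<otimes>\<^bsub>A\<^esub> monomial i)"
        using r by (simp add: X_c flip: A.m_assoc)
      then show ?thesis using X_monomial[of i] r by (auto intro!: c combs_monomial)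
    qed
    then show ?case using GenX combs_mult[OF X_closed] by (simp add: X_def)
  next
    case GenY
    have "Y \<otimes>\<^bsub>A\<^esub> (c r \<otimes>\<^bsub>A\<^esub> monomial i) \<in> combs" if r: "r \<in> carrier R" for r i
    proof -
      have "Y \<otimes>\<^bsub>A\<^esub> (c r \<otimes>\<^bsub>A\<^esub> monomial i) = c (\<sigma> r) \<otimes>\<^bsub>A\<^esub> (Y \<otimes>\<^bsub>A\<^esub> monomial i)"
        using r by (simp add: Y_c flip: A.m_assoc)
      then show ?thesis using Y_monomial[of i] r by (auto intro!: c combs_monomial)
    qed
    then show ?case using GenY combs_mult[OF Y_closed] by (simp add: Y_def)
  next
    case (Plus s t)
    have "gwa_class R \<sigma> a s \<in> carrier A" "gwa_class R \<sigma> a t \<in> carrier A" "u \<in> carrier A"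
      using Plus sub by (auto simp: gwa_simps)
    then have "gwa_class R \<sigma> a (Plus s t) \<otimes>\<^bsub>A\<^esub> u =
        gwa_class R \<sigma> a s \<otimes>\<^bsub>A\<^esub> u \<oplus>\<^bsub>A\<^esub> gwa_class R \<sigma> a t \<otimes>\<^bsub>A\<^esub> u"
      using Plus by (simp add: A.l_distr flip: gwa_simps(3))
    then show ?case using Plus combs_add by simp
  next
    case (Minus t)
    have t: "gwa_class R \<sigma> a t \<in> carrier A" "gwa_class R \<sigma> a (Minus t) \<in> carrier A" "u \<in> carrier A"
      using Minus sub by (auto simp: gwa_simps gwa_terms.Minus)
    have "gwa_class R \<sigma> a (Minus t) = \<ominus>\<^bsub>A\<^esub> gwa_class R \<sigma> a t"
      using t Minus(1) gwa_class_eqI[OF ring_axioms \<sigma>_hom a_closed gwa_rel.add_minus[where t = t and R = R and \<sigma> = \<sigma> and a = a]]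
      by (intro A.minus_equality[symmetric]) (simp_all add: gwa_simps gwa_terms.Minus)
    also have "\<dots> = c (\<ominus> \<one>) \<otimes>\<^bsub>A\<^esub> gwa_class R \<sigma> a t"
      using t by (simp add: c_uminus A.l_minus)
    finally have "gwa_class R \<sigma> a (Minus t) \<otimes>\<^bsub>A\<^esub> u = c (\<ominus> \<one>) \<otimes>\<^bsub>A\<^esub> (gwa_class R \<sigma> a t \<otimes>\<^bsub>A\<^esub> u)"
      using t by (simp add: A.m_assoc)
    then show ?case using Minus c by simp
  next
    case (Times s t)
    have "gwa_class R \<sigma> a s \<in> carrier A" "gwa_class R \<sigma> a t \<in> carrier A" "u \<in> carrier A"
      using Times sub by (auto simp: gwa_simps)
    then have "gwa_class R \<sigma> a (Times s t) \<otimes>\<^bsub>A\<^esub> u =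
        gwa_class R \<sigma> a s \<otimes>\<^bsub>A\<^esub> (gwa_class R \<sigma> a t \<otimes>\<^bsub>A\<^esub> u)"
      using Times by (simp add: A.m_assoc flip: gwa_simps(2))
    then show ?case using Times by simp
  qed
  have "\<one>\<^bsub>A\<^esub> \<in> combs"
    using combs_monomial[of \<one> 0] by (simp add: monomial_def)
  show "carrier A \<subseteq> combs"
  proof
    fix u assume u: "u \<in> carrier A"
    then obtain t where "t \<in> gwa_terms R" "u = gwa_class R \<sigma> a t" by (auto simp: gwa_simps)
    with terms[OF _ \<open>\<one>\<^bsub>A\<^esub> \<in> combs\<close>] u show "u \<in> combs" by (metis A.r_one)
  qed
qed

end


section \<open>Two-sided ideals\<close>

context gwa_domain
begin

lemma two_sided_ideal_meets_R:
  assumes a: "a \<noteq> \<zero>"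
    and inf: "\<And>n. n > 0 \<Longrightarrow> \<exists>r \<in> carrier R. (\<sigma> ^^ n) r \<noteq> r"
    and I: "ideal I A" "I \<noteq> {\<zero>\<^bsub>A\<^esub>}"
  shows "\<exists>r \<in> carrier R - {\<zero>}. c r \<in> I"
proof -
  interpret I: ideal I A by (rule I(1))
  \<comment> \<open>The minimum is taken over presentations with nonempty support and nonzero
    coefficients, not over nonzero elements, since uniqueness of expansions has not been
    shown.\<close>
  define P where "P z \<longleftrightarrow> finite (fst z) \<and> fst z \<noteq> {} \<and> snd z \<in> fst z \<rightarrow> carrier R - {\<zero>} \<and>
    comb (fst z) (snd z) \<in> I" for z
  have support: "comb F p = comb {i \<in> F. p i \<noteq> \<zero>} p" if "finite F" "p \<in> F \<rightarrow> carrier R" for F p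
    using that by (intro comb_mono_neutral[symmetric]) auto
  obtain u where u: "u \<in> I" "u \<noteq> \<zero>\<^bsub>A\<^esub>" using I(2) I.zero_closed by blast
  then have "u \<in> combs" using combs_eq_carrier I.Icarr by simp
  then obtain F0 p0 where F0: "finite F0" "p0 \<in> F0 \<rightarrow> carrier R" "u = comb F0 p0"
    unfolding combs_def by blast
  have u_eq: "u = comb {i \<in> F0. p0 i \<noteq> \<zero>} p0" using F0(3) support[OF F0(1,2)] by simp
  moreover have "comb {} p0 = \<zero>\<^bsub>A\<^esub>" by (simp add: comb_def)
  ultimately have "{i \<in> F0. p0 i \<noteq> \<zero>} \<noteq> {}" using u(2) by metis
  then have "P ({i \<in> F0. p0 i \<noteq> \<zero>}, p0)"
    using F0(1,2) u(1) u_eq by (simp add: P_def Pi_iff)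
  then obtain z where z: "P z" "\<And>y. P y \<Longrightarrow> card (fst z) \<le> card (fst y)"
    using ex_has_least_nat[of P _ "\<lambda>y. card (fst y)"] by blast
  define F p where "F = fst z" and "p = snd z"
  have min: "card F \<le> card G"
    if "finite G" "G \<noteq> {}" "q \<in> G \<rightarrow> carrier R - {\<zero>}" "comb G q \<in> I" for G q
    using z(2)[of "(G, q)"] that by (simp add: P_def F_def)
  have F: "finite F" "F \<noteq> {}" "p \<in> F \<rightarrow> carrier R" "\<And>i. i \<in> F \<Longrightarrow> p i \<noteq> \<zero>" "comb F p \<in> I"
    using z(1) by (auto simp: P_def F_def p_def)
  obtain k where k: "k \<in> F" using F by blast
  \<comment> \<open>commuting with \<open>r\<close> kills the \<open>k\<close>-th term of a shortest element\<close>
  have "\<sigma>_int i r = \<sigma>_int k r" if i: "i \<in> F" and r: "r \<in> carrier R" for i r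
  proof -
    let ?q = "\<lambda>i. p i \<otimes> (\<sigma>_int i r \<ominus> \<sigma>_int k r)"
    let ?G = "{i \<in> F. ?q i \<noteq> \<zero>}"
    have p: "p i \<in> carrier R" if "i \<in> F" for i using F that by auto
    have "comb F p \<otimes>\<^bsub>A\<^esub> c r \<oplus>\<^bsub>A\<^esub> c (\<ominus> \<sigma>_int k r) \<otimes>\<^bsub>A\<^esub> comb F p =
        comb F (\<lambda>i. p i \<otimes> \<sigma>_int i r \<oplus> (\<ominus> \<sigma>_int k r) \<otimes> p i)"
      using F r p by (simp add: comb_c c_comb comb_add)
    also have "\<dots> = comb F ?q"
      using r p by (intro comb_cong) (auto simp: a_minus_def r_distr m_comm)
    also have "\<dots> = comb ?G ?q"
      using F r p by (intro support) auto
    finally have "comb F p \<otimes>\<^bsub>A\<^esub> c r \<oplus>\<^bsub>A\<^esub> c (\<ominus> \<sigma>_int k r) \<otimes>\<^bsub>A\<^esub> comb F p = comb ?G ?q" .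
    moreover have "comb F p \<otimes>\<^bsub>A\<^esub> c r \<oplus>\<^bsub>A\<^esub> c (\<ominus> \<sigma>_int k r) \<otimes>\<^bsub>A\<^esub> comb F p \<in> I"
      using F(5) r by (intro I.a_closed I.I_l_closed I.I_r_closed) auto
    ultimately have "comb ?G ?q \<in> I" by simp
    moreover have "k \<notin> ?G" using p[OF k] r by (simp add: a_minus_def r_neg)
    then have "card ?G < card F" using F(1) k by (intro psubset_card_mono) blast+
    \<comment> \<open>A nonempty support smaller than \<open>F\<close> contradicts minimality, so
      every coefficient of the commutator vanishes.\<close>
    ultimately have "?G = {}"
      using min[of ?G ?q] F r p by (auto simp: Pi_iff)
    then have "?q i = \<zero>" using i by blast
    then have "\<sigma>_int i r \<ominus> \<sigma>_int k r = \<zero>"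
      using F i r p by (metis integral minus_closed \<sigma>_int_closed)
    then show ?thesis using r by simp
  qed
  \<comment> \<open>All exponents in \<open>F\<close> induce the same automorphism as
    \<open>k\<close>, and infinite order makes them equal.\<close>
  then have "F = {k}" using \<sigma>_int_faithful[OF inf] k by blast
  then have "c (p k) \<otimes>\<^bsub>A\<^esub> monomial k \<in> I"
    using F by (simp add: comb_def A.finsum_insert Pi_iff)
  moreover obtain d where d: "d \<in> carrier R - {\<zero>}" "monomial k \<otimes>\<^bsub>A\<^esub> monomial (- k) = c d"
    using monomial_mult_monomial_uminus[OF a] by blast
  ultimately have "c (p k) \<otimes>\<^bsub>A\<^esub> monomial k \<otimes>\<^bsub>A\<^esub> monomial (- k) \<in> I"
    using I.I_r_closed by simp
  moreover have "p k \<in> carrier R - {\<zero>}" using F k by auto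
  ultimately have "c (p k \<otimes> d) \<in> I" "p k \<otimes> d \<in> carrier R - {\<zero>}"
    using d by (auto simp: A.m_assoc ring_hom_mult[OF c_hom] integral_iff)
  then show ?thesis by blast
qed

section \<open>Divisibility and products along an orbit of \<sigma>\<close>

lemma ring_iso_divides:
  assumes "\<phi> \<in> ring_iso R R" "r \<in> carrier R" "r divides s"
  shows "\<phi> r divides \<phi> s"
  using assms ring_iso_memE(1,2)[OF assms(1)] by (auto simp: factor_def)

primrec orbit_prod :: "nat \<Rightarrow> 'a \<Rightarrow> 'a" where
  "orbit_prod 0 q = \<one>"
| "orbit_prod (Suc n) q = orbit_prod n q \<otimes> (\<sigma> ^^ n) q"

lemma orbit_prod_closed [simp]: "q \<in> carrier R \<Longrightarrow> orbit_prod n q \<in> carrier R"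
  by (induction n) auto

lemma orbit_prod_nonzero: "q \<in> carrier R \<Longrightarrow> q \<noteq> \<zero> \<Longrightarrow> orbit_prod n q \<noteq> \<zero>"
  by (induction n) (auto simp: integral_iff ring_iso_eq_zero_iff[OF \<sigma>_pow_iso])

text \<open>Telescoping: with \<open>e\<close> the orbit product,
  \<open>\<sigma>(e) / e = \<sigma>^n(q) / q\<close>, written without division.\<close>

lemma \<sigma>_orbit_prod: "q \<in> carrier R \<Longrightarrow> \<sigma> (orbit_prod n q) \<otimes> q = orbit_prod n q \<otimes> (\<sigma> ^^ n) q"
proof (induction n)
  case (Suc n)
  then show ?case
    using \<sigma>_pow_closed[of q n] \<sigma>_simps(1)[of "(\<sigma> ^^ n) q"]
    by (simp del: \<sigma>_pow_closed) (metis m_assoc m_comm orbit_prod_closed \<sigma>_simps(1))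
qed simp

lemma divides_orbit_prod:
  assumes "q \<in> carrier R" "n > 0"
  shows "q divides orbit_prod n q"
  using assms(2)
proof (induction n)
  case (Suc n)
  then show ?case
    using assms(1) by (cases "n = 0") (auto intro: divides_prod_r)
qed simp

end

section \<open>The non-field case: simple rank-one modules force a simple ring\<close>

locale gwa_pid = gwa_domain R \<sigma> a + principal_domain R
  for R :: "('a, 'r) ring_scheme" (structure) and \<sigma> a +
  assumes a_nonzero: "a \<noteq> \<zero>" and not_field: "\<not> field R"
    and simple: "\<And>f h. f \<in> carrier R \<Longrightarrow> h \<in> carrier R \<Longrightarrow> f \<otimes> h = a
      \<Longrightarrow> simple_module A (rank_one_module R \<sigma> f h)"
begin

lemma invariant_ideal:
  assumes fh: "f \<in> carrier R" "h \<in> carrier R" "f \<otimes> h = a"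
    and K: "ideal K R" "k \<in> K" "k \<noteq> \<zero>"
    and x: "\<And>r. r \<in> carrier R \<Longrightarrow> \<sigma> r \<in> K \<Longrightarrow> r \<otimes> f \<in> K"
    and y: "\<And>r. r \<in> K \<Longrightarrow> \<sigma> r \<otimes> \<sigma> h \<in> K"
  shows "K = carrier R"
  using simple[OF fh] submodule_rank_one[OF fh K(1) x y] K(2,3)
    rank_one_carrier[OF fh] rank_one_zero[OF fh]
  unfolding simple_module_def by auto

text \<open>The two divisibilities say that the principal ideal of \<open>\<sigma> e\<close>, rather
  than that of \<open>e\<close>, is stable under \<open>x\<close> and \<open>y\<close>. For
  \<open>x\<close>, \<open>\<sigma> r = \<sigma> e \<otimes> s\<close> gives
  \<open>r \<otimes> f = (e \<otimes> f) \<otimes> \<tau> s\<close>; for \<open>y\<close>, \<sigma>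
  is applied to the second divisibility.\<close>

lemma unit_criterion:
  assumes fh: "f \<in> carrier R" "h \<in> carrier R" "f \<otimes> h = a"
    and e: "e \<in> carrier R" "e \<noteq> \<zero>"
    and x: "\<sigma> e divides e \<otimes> f" and y: "e divides \<sigma> e \<otimes> h"
  shows "e \<in> Units R"
proof -
  have mem: "r \<in> PIdl (\<sigma> e) \<longleftrightarrow> r \<in> carrier R \<and> \<sigma> e divides r" for r
    using e(1) by (auto simp: cgenideal_def factor_def m_comm)
  have "PIdl (\<sigma> e) = carrier R"
  proof (rule invariant_ideal[OF fh])
    show "ideal (PIdl (\<sigma> e)) R" using e(1) by (simp add: cgenideal_ideal)
    show "\<sigma> e \<in> PIdl (\<sigma> e)" using e(1) by (simp add: mem)
    show "\<sigma> e \<noteq> \<zero>" using e ring_iso_eq_zero_iff[OF \<sigma>_iso] by simp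
  next
    fix r assume r: "r \<in> carrier R" "\<sigma> r \<in> PIdl (\<sigma> e)"
    then obtain s where s: "s \<in> carrier R" "\<sigma> r = \<sigma> e \<otimes> s" by (auto simp: mem factor_def)
    then have "\<sigma> r = \<sigma> (e \<otimes> \<tau> s)" using e(1) by simp
    then have "r = e \<otimes> \<tau> s" using r(1) s(1) e(1) by (simp only: \<sigma>_eq_iff m_closed \<tau>_simps(1))
    then have "r \<otimes> f = (e \<otimes> f) \<otimes> \<tau> s" using e(1) s(1) fh by (simp add: m_ac)
    then show "r \<otimes> f \<in> PIdl (\<sigma> e)"
      using x r(1) s(1) e(1) fh by (simp add: mem divides_prod_r)
  next
    fix r assume "r \<in> PIdl (\<sigma> e)"
    then obtain s where s: "s \<in> carrier R" "r = \<sigma> e \<otimes> s" by (auto simp: mem factor_def)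
    obtain t where t: "t \<in> carrier R" "\<sigma> e \<otimes> h = e \<otimes> t" using y by (auto simp: factor_def)
    then have "\<sigma> (\<sigma> e) \<otimes> \<sigma> h = \<sigma> e \<otimes> \<sigma> t" using e(1) fh by (metis \<sigma>_simps(1,3))
    then have "\<sigma> r \<otimes> \<sigma> h = \<sigma> e \<otimes> (\<sigma> t \<otimes> \<sigma> s)"
      using s e(1) fh t(1) by (simp add: m_ac) (metis m_assoc m_lcomm \<sigma>_simps(1))
    then show "\<sigma> r \<otimes> \<sigma> h \<in> PIdl (\<sigma> e)"
      using s e(1) fh t(1) by (auto simp: mem factor_def)
  qed
  then have "\<sigma> e \<in> Units R" using ideal_eq_carrier_iff[of "\<sigma> e"] e(1) by simp
  then obtain s where s: "s \<in> carrier R" "\<sigma> e \<otimes> s = \<one>" by (metis Units_closed Units_r_inv Units_inv_closed)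
  then have "\<tau> (\<sigma> e \<otimes> s) = \<one>" by simp
  then have "e \<otimes> \<tau> s = \<one>" using e(1) s(1) by (subst (asm) \<tau>_simps(3)) auto
  then show ?thesis using e(1) s(1) by (metis divides_one dividesI \<tau>_simps(1))
qed

lemma \<sigma>_pow_not_identity:
  assumes "n > 0"
  shows "\<exists>r \<in> carrier R. (\<sigma> ^^ n) r \<noteq> r"
proof (rule ccontr)
  assume id: "\<not> ?thesis"
  obtain q where q: "q \<in> carrier R" "q \<noteq> \<zero>" "q \<notin> Units R"
  proof -
    have "Units R \<noteq> carrier R - {\<zero>}"
      using not_field by (auto simp: field_def field_axioms_def domain_axioms)
    moreover have "\<zero> \<notin> Units R" using Units_l_inv[of \<zero>] by auto
    ultimately show thesis using that Units_closed by blast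
  qed
  let ?e = "orbit_prod n q"
  have "\<sigma> ?e \<otimes> q = ?e \<otimes> q" using \<sigma>_orbit_prod[OF q(1)] id q(1) by simp
  then have "\<sigma> ?e = ?e" using q m_rcancel[of q] by simp
  \<comment> \<open>With \<open>\<sigma> ?e = ?e\<close> both divisibilities are immediate for the
    factorization of \<open>a\<close> as \<open>a\<close> times 1.\<close>
  then have "?e \<in> Units R"
    using q by (intro unit_criterion[of a \<one>]) (auto simp: orbit_prod_nonzero intro: divides_prod_r)
  then show False
    using q divides_orbit_prod[OF q(1) assms] divides_unit by blast
qed

text \<open>Coprimality of \<open>a\<close> and \<open>\<sigma>^n(a)\<close> in ideal form. For a
  common prime divisor \<open>p = \<sigma>^n(q)\<close>, the telescoping identity
  \<open>\<sigma>(e) q = e p\<close> supplies the divisibilities of \<open>unit_criterion\<close>,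
  so that \<open>q\<close> would be a unit.\<close>

lemma coprime_shift:
  assumes n: "n > 0" and K: "ideal K R" "a \<in> K" "(\<sigma> ^^ n) a \<in> K"
  shows "K = carrier R"
proof (rule ccontr)
  assume neq: "K \<noteq> carrier R"
  obtain g where g: "g \<in> carrier R" "K = PIdl g" using exists_gen[OF K(1)] by blast
  have g0: "g \<noteq> \<zero>" using K(2) a_nonzero g by (auto simp: cgenideal_def)
  have "g \<notin> Units R" using neq g ideal_eq_carrier_iff[of g] by metis
  then obtain p where p: "p \<in> carrier R" "ring_irreducible p" "p divides g"
    using exists_irreducible_divisor g(1) g0 by blast
  have div: "p divides k" if "k \<in> K" for k
  proof -
    have "g divides k" using that g by (auto simp: cgenideal_def factor_def m_comm)
    then show ?thesis using p g(1) divides_trans by blast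
  qed
  have p0: "p \<noteq> \<zero>" and p_nonunit: "p \<notin> Units R"
    using p ring_irreducibleE by auto
  define q where "q = (\<tau> ^^ n) p"
  have q: "q \<in> carrier R" "(\<sigma> ^^ n) q = p" "q \<noteq> \<zero>"
    using p p0 ring_iso_eq_zero_iff[OF \<tau>_pow_iso] by (auto simp: q_def)
  have q_div: "q divides a"
    using ring_iso_divides[OF \<tau>_pow_iso[of n] p(1) div[OF K(3)]] by (simp add: q_def)
  obtain b where b: "b \<in> carrier R" "a = p \<otimes> b" using div[OF K(2)] by (auto simp: factor_def)
  let ?e = "orbit_prod n q"
  have e: "?e \<in> carrier R" "?e \<noteq> \<zero>" "\<sigma> ?e \<otimes> q = ?e \<otimes> p"
    using q \<sigma>_orbit_prod[of q n] by (auto simp: orbit_prod_nonzero)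
  have \<sigma>e: "\<sigma> ?e \<in> carrier R" using e(1) by simp
  \<comment> \<open>This is \<open>\<sigma>^n\<close> applied to the fact that \<open>q\<close>
    divides \<open>a = p b\<close>. Primeness of \<open>p\<close>, pulled back by
    \<open>\<tau>^n\<close>, then splits into \<open>q\<close> dividing \<open>p\<close> or
    \<open>b\<close>.\<close>
  have "p divides (\<sigma> ^^ n) p \<otimes> (\<sigma> ^^ n) b"
    using ring_iso_divides[OF \<sigma>_pow_iso[of n] q(1) q_div] q b p
      ring_iso_memE(2)[OF \<sigma>_pow_iso[of n]] by simp
  moreover have "prime R p"
    using primeness_condition p p0 ring_primeE by blast
  ultimately have "p divides (\<sigma> ^^ n) p \<or> p divides (\<sigma> ^^ n) b"
    using p b by (meson primeE \<sigma>_pow_closed)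
  then have "q divides p \<or> q divides b"
    using ring_iso_divides[OF \<tau>_pow_iso[of n] p(1)] p b unfolding q_def by fastforce
  then have "?e \<in> Units R"
  proof
    \<comment> \<open>Here \<open>\<sigma>(e) = e u\<close> and
      \<open>e a = \<sigma>(e) q b\<close>, so \<open>a\<close> times 1 is a suitable
      factorization.\<close>
    assume "q divides p"
    then obtain u where u: "u \<in> carrier R" "p = q \<otimes> u" by (auto simp: factor_def)
    then have "\<sigma> ?e = ?e \<otimes> u"
      using e q \<sigma>e m_rcancel[of q "\<sigma> ?e" "?e \<otimes> u"] by (simp add: m_ac)
    moreover have "?e \<otimes> a = \<sigma> ?e \<otimes> (q \<otimes> b)"
      using e b p q \<sigma>e by (metis m_assoc)
    ultimately show ?thesis
      using e u q b \<sigma>e by (intro unit_criterion[of a \<one>]) (auto simp: factor_def)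
  next
    \<comment> \<open>Here the factorization is \<open>a = p (q b')\<close>: one has
      \<open>e p = \<sigma>(e) q\<close> and \<open>\<sigma>(e) q b' = e p b'\<close>.\<close>
    assume "q divides b"
    then obtain b' where b': "b' \<in> carrier R" "b = q \<otimes> b'" by (auto simp: factor_def)
    have "\<sigma> ?e \<otimes> (q \<otimes> b') = ?e \<otimes> (p \<otimes> b')"
      using e b' p q \<sigma>e by (metis m_assoc)
    then show ?thesis
      using e(1,2) e(3)[symmetric] q b b' p \<sigma>e
      by (intro unit_criterion[of p "q \<otimes> b'"]) (auto simp: factor_def)
  qed
  then have "q \<in> Units R"
    using q divides_orbit_prod[OF q(1) n] divides_unit by blast
  then have "q divides \<one>" using q(1) divides_one by blast
  from ring_iso_divides[OF \<sigma>_pow_iso[of n] q(1) this] have "p divides \<one>"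
    using q(2) ring_iso_memE(4)[OF \<sigma>_pow_iso[of n]] by simp
  then have "p \<in> Units R" using p(1) divides_one by blast
  then show False using p_nonunit by simp
qed

lemma simple_ring_gwa: "simple_ring A"
  unfolding simple_ring_def
proof (intro conjI allI impI disjCI)
  show "ring A" by (rule A.ring_axioms)
  show "carrier A \<noteq> {\<zero>\<^bsub>A\<^esub>}"
  proof
    \<comment> \<open>That the presentation does not collapse is seen from the action on the nonzero
      module \<open>R\<close>.\<close>
    assume 0: "carrier A = {\<zero>\<^bsub>A\<^esub>}"
    have one: "\<one> \<in> carrier R" "a \<otimes> \<one> = a" by auto
    interpret M: left_module A "rank_one_module R \<sigma> a \<one>"
      using left_module_rank_one[OF a_closed one] .
    have "\<one>\<^bsub>A\<^esub> = \<zero>\<^bsub>A\<^esub>" using 0 A.one_closed by blast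
    then have "\<one> = \<zero>"
      using M.smult_one[of \<one>] M.zero_smult[of \<one>]
      by (simp add: rank_one_carrier[OF a_closed one] rank_one_zero[OF a_closed one])
    then show False by simp
  qed
  fix I assume I: "ideal I A" and "I \<noteq> carrier A"
  show "I = {\<zero>\<^bsub>A\<^esub>}"
  proof (rule ccontr)
    assume "I \<noteq> {\<zero>\<^bsub>A\<^esub>}"
    interpret I: ideal I A by (rule I)
    obtain r0 where r0: "r0 \<in> carrier R" "r0 \<noteq> \<zero>" "c r0 \<in> I"
      using two_sided_ideal_meets_R[OF a_nonzero \<sigma>_pow_not_identity I \<open>I \<noteq> {\<zero>\<^bsub>A\<^esub>}\<close>] by blast
    \<comment> \<open>Scalars \<open>r\<close> with \<open>r Y^n\<close> in \<open>I\<close>. The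
      sets increase with \<open>n\<close>, \<sigma> maps \<open>J n\<close> into
      \<open>J (Suc n)\<close>, and \<open>X\<close> leads back from \<open>J (Suc n)\<close> to
      \<open>J n\<close>.\<close>
    define J where "J n = {r \<in> carrier R. c r \<otimes>\<^bsub>A\<^esub> Y [^]\<^bsub>A\<^esub> n \<in> I}" for n :: nat
    have J_ideal: "ideal (J n) R" for n
    proof (rule idealI)
      show "subgroup (J n) (add_monoid R)"
      proof (rule add.subgroupI)
        show "J n \<noteq> {}" using I.zero_closed by (auto simp: J_def intro!: exI[of _ \<zero>])
        show "\<ominus> r \<in> J n" if "r \<in> J n" for r
          using that I.a_inv_closed by (auto simp: J_def c_uminus A.l_minus)
        show "r \<oplus> s \<in> J n" if "r \<in> J n" "s \<in> J n" for r s
          using that by (auto simp: J_def ring_hom_add[OF c_hom] A.l_distr I.a_closed)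
      qed (auto simp: J_def)
      show "s \<otimes> r \<in> J n" if "r \<in> J n" "s \<in> carrier R" for r s
        using that by (auto simp: J_def ring_hom_mult[OF c_hom] A.m_assoc I.I_l_closed)
      then show "r \<otimes> s \<in> J n" if "r \<in> J n" "s \<in> carrier R" for r s
        using that m_comm[of r s] by (auto simp: J_def)
    qed (rule R.ring_axioms)
    have J_Suc: "J n \<subseteq> J (Suc n)" for n
    proof
      fix r assume "r \<in> J n"
      then have "r \<in> carrier R" "c r \<otimes>\<^bsub>A\<^esub> Y [^]\<^bsub>A\<^esub> n \<otimes>\<^bsub>A\<^esub> Y \<in> I"
        using I.I_r_closed by (simp_all add: J_def)
      then show "r \<in> J (Suc n)" by (simp add: J_def A.m_assoc)
    qed
    have J_mono: "J m \<subseteq> J n" if "m \<le> n" for m n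
      using lift_Suc_mono_le[of J, OF J_Suc that] .
    have J_\<sigma>: "\<sigma> r \<in> J (Suc n)" if "r \<in> J n" for r n
    proof -
      have r: "r \<in> carrier R" using that by (simp add: J_def)
      have "c (\<sigma> r) \<otimes>\<^bsub>A\<^esub> Y [^]\<^bsub>A\<^esub> Suc n = Y \<otimes>\<^bsub>A\<^esub> (c r \<otimes>\<^bsub>A\<^esub> Y [^]\<^bsub>A\<^esub> n)"
        unfolding A.nat_pow_Suc2[OF Y_closed] using r Y_c[OF r] by (simp flip: A.m_assoc)
      then show ?thesis using that r I.I_l_closed[of _ Y] by (auto simp: J_def)
    qed
    have J_x: "r \<otimes> a \<in> J n" if r: "r \<in> carrier R" and "\<sigma> r \<in> J (Suc n)" for r n
    proof -
      have "X \<otimes>\<^bsub>A\<^esub> (c (\<sigma> r) \<otimes>\<^bsub>A\<^esub> Y [^]\<^bsub>A\<^esub> Suc n) = (X \<otimes>\<^bsub>A\<^esub> c (\<sigma> r)) \<otimes>\<^bsub>A\<^esub> (Y \<otimes>\<^bsub>A\<^esub> Y [^]\<^bsub>A\<^esub> n)"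
        unfolding A.nat_pow_Suc2[OF Y_closed] using r by (simp add: A.m_assoc)
      also have "\<dots> = c r \<otimes>\<^bsub>A\<^esub> (X \<otimes>\<^bsub>A\<^esub> Y) \<otimes>\<^bsub>A\<^esub> Y [^]\<^bsub>A\<^esub> n"
        using r by (simp add: X_c A.m_assoc)
      also have "\<dots> = c (r \<otimes> a) \<otimes>\<^bsub>A\<^esub> Y [^]\<^bsub>A\<^esub> n"
        using r by (simp add: X_Y ring_hom_mult[OF c_hom])
      finally have "c (r \<otimes> a) \<otimes>\<^bsub>A\<^esub> Y [^]\<^bsub>A\<^esub> n = X \<otimes>\<^bsub>A\<^esub> (c (\<sigma> r) \<otimes>\<^bsub>A\<^esub> Y [^]\<^bsub>A\<^esub> Suc n)" ..
      then show ?thesis using that r I.I_l_closed[of _ X] by (auto simp: J_def)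
    qed
    have "subset.chain {I. ideal I R} (range J)"
      unfolding subset.chain_def
    proof (intro conjI ballI)
      fix K L assume "K \<in> range J" "L \<in> range J"
      then obtain m n where "K = J m" "L = J n" by blast
      then show "(\<subset>)\<^sup>=\<^sup>= K L \<or> (\<subset>)\<^sup>=\<^sup>= L K"
        using J_mono[of m n] J_mono[of n m] nat_le_linear[of m n] by auto
    qed (use J_ideal in auto)
    then have "ideal (\<Union>n. J n) R"
      using chain_Union_is_ideal[of "range J"] by simp
    moreover have "r0 \<in> (\<Union>n. J n)" using r0 by (auto simp: J_def intro!: exI[of _ 0])
    ultimately have "(\<Union>n. J n) = carrier R"
    proof (rule invariant_ideal[OF a_closed R.one_closed r_one[OF a_closed] _ _ r0(2)])
      fix r assume r: "r \<in> carrier R" "\<sigma> r \<in> (\<Union>n. J n)"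
      \<comment> \<open>Monotonicity allows a positive index, so that one factor \<open>Y\<close> is
        there for \<open>X\<close> to cancel.\<close>
      then obtain n where "\<sigma> r \<in> J (Suc n)" using J_Suc by blast
      then show "r \<otimes> a \<in> (\<Union>n. J n)" using J_x r by blast
    next
      fix r assume "r \<in> (\<Union>n. J n)"
      then obtain n where "r \<in> J n" by blast
      then have "\<sigma> r \<in> J (Suc n)" "r \<in> carrier R" using J_\<sigma> by (auto simp: J_def)
      then show "\<sigma> r \<otimes> \<sigma> \<one> \<in> (\<Union>n. J n)" by auto
    qed
    then have ex: "\<exists>n. \<one> \<in> J n" by blast
    define n where "n = (LEAST n. \<one> \<in> J n)"
    have n: "\<one> \<in> J n" using LeastI_ex[OF ex] by (simp add: n_def)
    show False
    proof (cases n)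
      case 0
      then have "\<one>\<^bsub>A\<^esub> \<in> I" using n by (simp add: J_def)
      then show False using I.one_imp_carrier \<open>I \<noteq> carrier A\<close> by blast
    next
      case (Suc m)
      have "a \<in> J m" using J_x[of \<one> m] n Suc by simp
      \<comment> \<open>Left multiplication by \<open>X\<close> gave \<open>a\<close>; multiplying
        \<open>Y^n\<close> by \<open>X\<close> on the right gives the shifted element in the same
        degree.\<close>
      moreover have "(\<sigma> ^^ n) a \<in> J m"
      proof -
        have "Y [^]\<^bsub>A\<^esub> n \<otimes>\<^bsub>A\<^esub> X \<in> I" using n I.I_r_closed[of _ X] by (auto simp: J_def)
        also have "Y [^]\<^bsub>A\<^esub> n \<otimes>\<^bsub>A\<^esub> X = Y [^]\<^bsub>A\<^esub> m \<otimes>\<^bsub>A\<^esub> c (\<sigma> a)"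
          by (simp add: Suc A.m_assoc Y_X)
        also have "\<dots> = c ((\<sigma> ^^ n) a) \<otimes>\<^bsub>A\<^esub> Y [^]\<^bsub>A\<^esub> m"
          by (simp add: Y_pow_c Suc funpow_swap1)
        finally show ?thesis by (simp add: J_def)
      qed
      ultimately have "J m = carrier R"
        using coprime_shift[OF _ J_ideal] Suc by blast
      then have "\<one> \<in> J m" by simp
      then have "n \<le> m" unfolding n_def by (rule Least_le)
      then show False using Suc by simp
    qed
  qed
qed

end

section \<open>Both directions of the equivalence\<close>

lemma (in gwa_domain) simple_module_of_free_rank_one:
  assumes "field R \<or> simple_ring A" and M: "left_module A M"
    and "free_of_rank R 1 (restrict_scalars c M)"
  shows "simple_module A M"
proof -
  obtain v where "v \<in> carrier M" "v \<noteq> \<zero>\<^bsub>M\<^esub>"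
    "\<And>w. w \<in> carrier M \<Longrightarrow> \<exists>r \<in> carrier R. w = c r \<odot>\<^bsub>M\<^esub> v"
    using free_of_rank_one_generator[OF R.ring_axioms one_not_zero c_hom M assms(3)] by blast
  then show ?thesis
    by (rule simple_module_of_cyclic[OF domain_axioms c_hom M _ _ _ assms(1)])
qed

(* HOL cannot quantify over types inside a formula.  The equivalence ranges over the A-modules
   with carrier in the type 'a of the elements of R; every module that is free of rank 1 over R
   is isomorphic to one of these.  The second conjunct gives simplicity for modules with carrier
   in an arbitrary type 'm, so no module is left out. *)
theorem theorem3p3:
  fixes R :: "('a, 'r) ring_scheme" and \<sigma> :: "'a \<Rightarrow> 'a" and a :: 'a
    and A :: "'a gwa_term set ring"
  assumes "principal_domain R"
    and "\<sigma> \<in> ring_iso R R"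
    and "a \<in> carrier R" and "a \<noteq> \<zero>\<^bsub>R\<^esub>"
  defines "A \<equiv> gwa R \<sigma> a"
  shows
    "((\<forall>M :: ('a gwa_term set, 'a) module.
          left_module A M \<and> free_of_rank R 1 (restrict_scalars (gwa_coeff R \<sigma> a) M)
            \<longrightarrow> simple_module A M)
        \<longleftrightarrow> field R \<or> simple_ring A)
     \<and> (field R \<or> simple_ring A \<longrightarrow>
         (\<forall>M :: ('a gwa_term set, 'm) module.
            left_module A M \<and> free_of_rank R 1 (restrict_scalars (gwa_coeff R \<sigma> a) M)
              \<longrightarrow> simple_module A M))"
proof (intro conjI iffI impI)
  interpret R: principal_domain R by (rule assms(1))
  interpret gwa_domain R \<sigma> a
    by unfold_locales (use assms in auto)
  show "\<forall>M :: ('a gwa_term set, 'a) module.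
      left_module A M \<and> free_of_rank R 1 (restrict_scalars (gwa_coeff R \<sigma> a) M)
        \<longrightarrow> simple_module A M" if "field R \<or> simple_ring A"
    using simple_module_of_free_rank_one that unfolding A_def by blast
  show "\<forall>M :: ('a gwa_term set, 'm) module.
      left_module A M \<and> free_of_rank R 1 (restrict_scalars (gwa_coeff R \<sigma> a) M)
        \<longrightarrow> simple_module A M" if "field R \<or> simple_ring A"
    using simple_module_of_free_rank_one that unfolding A_def by blast
  assume all: "\<forall>M :: ('a gwa_term set, 'a) module.
      left_module A M \<and> free_of_rank R 1 (restrict_scalars (gwa_coeff R \<sigma> a) M)
        \<longrightarrow> simple_module A M"
  show "field R \<or> simple_ring A"
  proof (cases "field R")
    case False
    \<comment> \<open>The modules built from factorizations of \<open>a\<close> have carrier in the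
      type \<open>'a\<close>, so the hypothesis \<open>all\<close> applies to them.\<close>
    interpret gwa_pid R \<sigma> a
      using all left_module_rank_one free_of_rank_rank_one assms(4) False
      by unfold_locales (auto simp: A_def)
    show ?thesis unfolding A_def using simple_ring_gwa by blast
  qed simp
qed

end
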